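(* Let $(X,\mu)$ be a homogeneous space of dimension $s$ with $\mu$ nonatomic. Let $B_0\subset X$ be a ball, and let $f$ be a function with $\operatorname{supp}(f)\subset B_0$. Let $Z(X)$ be an r.i. space and let $\phi_{Z'}$ denote the fundamental function of its associate space $Z'(X)$. Let $\|f\|_0=\mu(\operatorname{supp}(f))$, and let $c_2\in(0,1]$ be the symmetrization constant of $X$ described in the context. Let $\sigma\ge1$ and $c_P>0$. (i) Let $p,q\ge1$, and suppose $f$ and $g\ge0$ satisfy a $p$-$q$-Poincaré inequality on $4\sigma B_0$ with constants $c_P,\sigma$. If $\|f\|_0<c_2\,\mu(B_0)$, then $$\|f\|_{L^p(X)}\le c\,\big[\|g^q\|_{Z(X)}\,\phi_{Z'}(\|f\|_0)\big]^{1/q}\,\|f\|_0^{\frac{s+p}{sp}-\frac1q}.$$ (ii) Let $q\ge 1$, $q>s$, and suppose $f$ and $g\ge0$ satisfy a $1$-$q$-Poincaré inequality on $4\sigma B_0$ with constants $c_P,\sigma$. If $\|f\|_0<c_2\,\mu(B_0)$, then $$\|f\|_{L^\infty(X)}\le c\,\big[\|g^q\|_{Z(X)}\,\phi_{Z'}(\|f\|_0)\big]^{1/q}\,\|f\|_0^{\frac1s-\frac1q}.$$ Here $c>0$ denotes a constant independent of $f$ and $g$.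
   Context: A homogeneous space consists of a metric space $X$ and a Borel measure $\mu$ on $X$ with $0<\mu(B(x,r))<\infty$ for all $x\in X$, $r>0$, and satisfying the doubling condition $\mu(B(x,2r))\le c_d\,\mu(B(x,r))$ for all $x\in X$, $r>0$. If $c_d$ is the smallest such constant, $s=\log_2 c_d$ is called the dimension (doubling order) of $\mu$. $B(x,r)$ is the open ball; for a ball $B=B(x,r)$, $r(B)=r$ is its radius and $\varrho B=B(x,\varrho r)$. $p$-$q$-Poincaré inequality: let $\Omega\subset X$ be measurable, $f,g$ measurable functions on $\Omega$, $g\ge0$. They satisfy a $p$-$q$-Poincaré inequality on $\Omega$ with constants $c_P>0$, $\sigma\ge1$ if, for every ball $B$ with $\sigma B\subset\Omega$, $$\Big(\frac1{\mu(B)}\int_B|f-f_B|^p\,d\mu\Big)^{1/p}\le c_P\,r(B)\Big(\frac1{\mu(\sigma B)}\int_{\sigma B}g^q\,d\mu\Big)^{1/q},\qquad f_B=\frac1{\mu(B)}\int_B f\,d\mu$$ (in particular $f$ is integrable over each such $B$). One then calls $f$ a $p$-$q$-Sobolev function and $g$ its gradient. For a measurable function $h$, $h^*$ is the decreasing rearrangement of $|h|$ with respect to $\mu$ (functions defined on a subset of $X$ are extended by zero), and $h^{**}(t)=\frac1t\int_0^t h^*(u)\,du$. The constant $c_2$: it is a constant $c_2\in(0,1]$ depending only on $X$ such that for all $p,q\ge1$, $\sigma\ge1$, $c_P>0$ and every ball $B_0$ there is $c_1>0$ with the property that, for all $f,g$ satisfying a $p$-$q$-Poincaré inequality on $4\sigma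 B_0$ with constants $c_P,\sigma$, $$t^{-\frac1s}\Big(\frac1t\int_0^t\big([f\chi_{B_0}]^*(u)-[f\chi_{B_0}]^*(t)\big)^p\,du\Big)^{1/p}\le c_1\,[(g^q)^{**}(t)]^{1/q},\qquad 0<t<c_2\,\mu(B_0).$$ A rearrangement invariant (r.i.) space $Z=Z(X)$ is a Banach function space (in the sense of Bennett–Sharpley) of $\mu$-measurable functions on $X$ such that $f\in Z$ and $g^*=f^*$ imply $g\in Z$ and $\|g\|_Z=\|f\|_Z$. Its associate space $Z'$ has norm $\|k\|_{Z'}=\sup\{\int_X|hk|\,d\mu:\|h\|_Z\le1\}$. The fundamental function of an r.i. space $Y$ is $\phi_Y(t)=\|\chi_E\|_Y$, where $E\subset X$ is any set with $\mu(E)=t$. *)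

theory Defs
  imports "HOL-Probability.Essential_Supremum"
begin

definition doubling_constant :: "'a::metric_space measure \<Rightarrow> real \<Rightarrow> bool" where
  "doubling_constant M c \<longleftrightarrow>
     (\<forall>x. \<forall>r>0. measure M (ball x (2 * r)) \<le> c * measure M (ball x r))"

definition homogeneous_space :: "'a::metric_space measure \<Rightarrow> bool" where
  "homogeneous_space M \<longleftrightarrow>
     sets M = sets borel \<and>
     (\<forall>x. \<forall>r>0. 0 < emeasure M (ball x r) \<and> emeasure M (ball x r) < \<infinity>) \<and>
     (\<exists>c. doubling_constant M c)"

text \<open>In a homogeneous space the infimum is attained.\<close>

definition doubling_dimension :: "'a::metric_space measure \<Rightarrow> real" where
  "doubling_dimension M = log 2 (Inf {c. doubling_constant M c})"

definition nonatomic :: "'a measure \<Rightarrow> bool" where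
  "nonatomic M \<longleftrightarrow>
     (\<forall>A\<in>sets M. 0 < emeasure M A \<longrightarrow>
        (\<exists>B\<in>sets M. B \<subseteq> A \<and> 0 < emeasure M B \<and> emeasure M B < emeasure M A))"

text \<open>Used for positive exponents only.\<close>

definition ennreal_powr :: "ennreal \<Rightarrow> real \<Rightarrow> ennreal" where
  "ennreal_powr x a = (if x = \<infinity> then \<infinity> else ennreal (enn2real x powr a))"

definition Lp_norm :: "'a measure \<Rightarrow> real \<Rightarrow> ('a \<Rightarrow> real) \<Rightarrow> ennreal" where
  "Lp_norm M p f = ennreal_powr (\<integral>\<^sup>+x. ennreal (\<bar>f x\<bar> powr p) \<partial>M) (1 / p)"

definition Linf_norm :: "'a measure \<Rightarrow> ('a \<Rightarrow> real) \<Rightarrow> ennreal" where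
  "Linf_norm M f = esssup M (\<lambda>x. ennreal \<bar>f x\<bar>)"

definition ball_average :: "'a measure \<Rightarrow> 'a set \<Rightarrow> ('a \<Rightarrow> real) \<Rightarrow> real" where
  "ball_average M B f = (LINT x:B|M. f x) / measure M B"

text \<open>
  The functions matter on \<open>\<Omega>\<close> only. Balls are given by a centre and a radius, since neither is
  determined by the underlying set. The inequality is one between extended nonnegative reals:
  its right-hand side, and for \<open>p > 1\<close> its left-hand side, may be infinite.
\<close>

definition poincare ::
  "'a::metric_space measure \<Rightarrow> 'a set \<Rightarrow> real \<Rightarrow> real \<Rightarrow> real \<Rightarrow> real \<Rightarrow> ('a \<Rightarrow> real) \<Rightarrow> ('a \<Rightarrow> real) \<Rightarrow> bool"
  where
  "poincare M \<Omega> p q cP \<sigma> f g \<longleftrightarrow>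
     \<Omega> \<in> sets M \<and>
     f \<in> borel_measurable (restrict_space M \<Omega>) \<and>
     g \<in> borel_measurable (restrict_space M \<Omega>) \<and>
     (\<forall>x\<in>\<Omega>. 0 \<le> g x) \<and>
     (\<forall>x r. 0 < r \<and> ball x (\<sigma> * r) \<subseteq> \<Omega> \<longrightarrow>
        set_integrable M (ball x r) f \<and>
        ennreal_powr
          ((\<integral>\<^sup>+y\<in>ball x r. ennreal (\<bar>f y - ball_average M (ball x r) f\<bar> powr p) \<partial>M)
             / emeasure M (ball x r)) (1 / p)
        \<le> ennreal (cP * r) *
          ennreal_powr
            ((\<integral>\<^sup>+y\<in>ball x (\<sigma> * r). ennreal (g y powr q) \<partial>M) / emeasure M (ball x (\<sigma> * r))) (1 / q))"

definition rearrangement :: "'a measure \<Rightarrow> ('a \<Rightarrow> ennreal) \<Rightarrow> real \<Rightarrow> ennreal" where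
  "rearrangement M h t = Inf {y. emeasure M {x\<in>space M. y < h x} \<le> ennreal t}"

definition maximal_rearrangement :: "'a measure \<Rightarrow> ('a \<Rightarrow> ennreal) \<Rightarrow> real \<Rightarrow> ennreal" where
  "maximal_rearrangement M h t = (\<integral>\<^sup>+u\<in>{0<..<t}. rearrangement M h u \<partial>lborel) / ennreal t"

text \<open>The function \<open>g\<^sup>q\<close>, given on \<open>\<Omega>\<close> and extended by zero.\<close>

definition power_ext :: "'a set \<Rightarrow> real \<Rightarrow> ('a \<Rightarrow> real) \<Rightarrow> 'a \<Rightarrow> ennreal" where
  "power_ext \<Omega> q g x = (if x \<in> \<Omega> then ennreal (g x powr q) else 0)"

text \<open>The difference of rearrangements is a truncated one, but \<open>u < t\<close> on the range of integration.\<close>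

definition symmetrization_constant :: "'a::metric_space measure \<Rightarrow> real \<Rightarrow> bool" where
  "symmetrization_constant M c2 \<longleftrightarrow>
     0 < c2 \<and> c2 \<le> 1 \<and>
     (\<forall>p\<ge>1. \<forall>q\<ge>1. \<forall>\<sigma>\<ge>1. \<forall>cP>0. \<forall>x0. \<forall>r0>0. \<exists>c1>0. \<forall>f g.
        poincare M (ball x0 (4 * \<sigma> * r0)) p q cP \<sigma> f g \<longrightarrow>
        (\<forall>t. 0 < t \<and> t < c2 * measure M (ball x0 r0) \<longrightarrow>
           (let F = rearrangement M (\<lambda>x. ennreal \<bar>f x\<bar> * indicator (ball x0 r0) x) in
              ennreal (t powr (- 1 / doubling_dimension M)) *
              ennreal_powr
                ((\<integral>\<^sup>+u\<in>{0<..<t}. ennreal_powr (F u - F t) p \<partial>lborel) / ennreal t) (1 / p)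
              \<le> ennreal c1 *
                ennreal_powr
                  (maximal_rearrangement M (power_ext (ball x0 (4 * \<sigma> * r0)) q g) t) (1 / q))))"

text \<open>
  Following Bennett and Sharpley, a Banach function space is given by a function norm \<open>\<rho>\<close> on the
  cone of measurable functions with values in \<open>[0, \<infinity>]\<close>; values of \<open>\<rho>\<close> elsewhere are irrelevant.
\<close>

definition banach_function_norm :: "'a measure \<Rightarrow> (('a \<Rightarrow> ennreal) \<Rightarrow> ennreal) \<Rightarrow> bool" where
  "banach_function_norm M \<rho> \<longleftrightarrow>
     (\<forall>h\<in>borel_measurable M. \<rho> h = 0 \<longleftrightarrow> (AE x in M. h x = 0)) \<and>
     (\<forall>h\<in>borel_measurable M. \<forall>a\<ge>0. \<rho> (\<lambda>x. ennreal a * h x) = ennreal a * \<rho> h) \<and>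
     (\<forall>h\<in>borel_measurable M. \<forall>k\<in>borel_measurable M. \<rho> (\<lambda>x. h x + k x) \<le> \<rho> h + \<rho> k) \<and>
     (\<forall>h\<in>borel_measurable M. \<forall>k\<in>borel_measurable M. (AE x in M. h x \<le> k x) \<longrightarrow> \<rho> h \<le> \<rho> k) \<and>
     (\<forall>H. \<forall>h\<in>borel_measurable M. (\<forall>n::nat. H n \<in> borel_measurable M) \<and>
        (AE x in M. incseq (\<lambda>n. H n x) \<and> (\<lambda>n. H n x) \<longlonglongrightarrow> h x) \<longrightarrow>
        (\<lambda>n. \<rho> (H n)) \<longlonglongrightarrow> \<rho> h) \<and>
     (\<forall>E\<in>sets M. emeasure M E < \<infinity> \<longrightarrow> \<rho> (indicator E) < \<infinity>) \<and>
     (\<forall>E\<in>sets M. emeasure M E < \<infinity> \<longrightarrow>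
        (\<exists>C>0. \<forall>h\<in>borel_measurable M. (\<integral>\<^sup>+x\<in>E. h x \<partial>M) \<le> ennreal C * \<rho> h))"

definition function_space :: "'a measure \<Rightarrow> (('a \<Rightarrow> ennreal) \<Rightarrow> ennreal) \<Rightarrow> ('a \<Rightarrow> real) set" where
  "function_space M \<rho> = {f\<in>borel_measurable M. \<rho> (\<lambda>x. ennreal \<bar>f x\<bar>) < \<infinity>}"

definition ri_norm :: "'a measure \<Rightarrow> (('a \<Rightarrow> ennreal) \<Rightarrow> ennreal) \<Rightarrow> bool" where
  "ri_norm M \<rho> \<longleftrightarrow>
     banach_function_norm M \<rho> \<and>
     (\<forall>f\<in>function_space M \<rho>. \<forall>g\<in>borel_measurable M.
        rearrangement M (\<lambda>x. ennreal \<bar>g x\<bar>) = rearrangement M (\<lambda>x. ennreal \<bar>f x\<bar>) \<longrightarrow>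
        g \<in> function_space M \<rho> \<and> \<rho> (\<lambda>x. ennreal \<bar>g x\<bar>) = \<rho> (\<lambda>x. ennreal \<bar>f x\<bar>))"

definition associate_norm ::
  "'a measure \<Rightarrow> (('a \<Rightarrow> ennreal) \<Rightarrow> ennreal) \<Rightarrow> ('a \<Rightarrow> ennreal) \<Rightarrow> ennreal" where
  "associate_norm M \<rho> k = (SUP h\<in>{h\<in>borel_measurable M. \<rho> h \<le> 1}. \<integral>\<^sup>+x. h x * k x \<partial>M)"

text \<open>
  For a rearrangement invariant norm the value does not depend on the choice of the set. If \<open>M\<close> is
  nonatomic, a set of measure \<open>t\<close> exists for every \<open>t\<close> between \<open>0\<close> and the measure of the space.
\<close>

definition fundamental_function ::
  "'a measure \<Rightarrow> (('a \<Rightarrow> ennreal) \<Rightarrow> ennreal) \<Rightarrow> real \<Rightarrow> ennreal" where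
  "fundamental_function M \<rho> t = \<rho> (indicator (SOME E. E \<in> sets M \<and> emeasure M E = ennreal t))"

text \<open>
  For measurable functions on a metric space the support is understood either as the set where the
  function does not vanish or as the closure of that set. Neither choice is more general than the
  other here, so both are admitted.
\<close>

definition is_support :: "('a::metric_space \<Rightarrow> real) \<Rightarrow> 'a set \<Rightarrow> bool" where
  "is_support f S \<longleftrightarrow> S = support_on UNIV f \<or> S = closure (support_on UNIV f)"

end

theory Submission
  imports Defs
begin

text \<open>
  Write \<open>t\<close> for the measure of the support, \<open>f\<^sup>*\<close> for the rearrangement of \<open>f\<close> and \<open>G = g\<^sup>q\<close>. Since
  \<open>f\<close> vanishes off a set of measure \<open>t\<close>, one has \<open>f\<^sup>*(t) = 0\<close>, and this is what turns the
  symmetrized inequality, which controls oscillations of \<open>f\<^sup>*\<close> only, into a bound for \<open>f\<close> itself.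

  On the right-hand side of that inequality stands the integral of \<open>G\<^sup>*\<close> over \<open>(0, t)\<close>. As the
  measure is nonatomic, a level set of \<open>G\<close> can be trimmed to a set \<open>E\<close> of measure exactly \<open>t\<close>, and
  then this integral equals the integral of \<open>G\<close> over \<open>E\<close> (\<open>nonatomic_level_set\<close>,
  \<open>nn_integral_rearrangement\<close>). Hoelder's inequality bounds it by the norm of \<open>G\<close> times the
  associate norm of the indicator of \<open>E\<close>, and by rearrangement invariance the latter depends on the
  measure of \<open>E\<close> only, so it is the fundamental function at \<open>t\<close> (\<open>associate_norm_indicator_le\<close>).
  The outcome is \<open>integral_rearrangement_le\<close>, with a bound \<open>R\<close> that also serves every \<open>u \<le> t\<close>.

  Part (i) is the symmetrized inequality at \<open>t\<close>, because \<open>f\<close> and \<open>f\<^sup>*\<close> are equimeasurable and have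
  the same \<open>L\<^sup>p\<close> norm. For part (ii) it is used with \<open>p = 1\<close> at every \<open>u \<le> t\<close>: the mean oscillation
  of \<open>f\<^sup>*\<close> on \<open>(0, u)\<close> bounds the increment \<open>f\<^sup>*(u/2) - f\<^sup>*(u)\<close> by a multiple of
  \<open>u powr (1/s - 1/q) * R powr (1/q)\<close>. The exponent \<open>1/s - 1/q\<close> is positive exactly because
  \<open>q > s\<close>, so the increments along \<open>t, t/2, t/4, ...\<close> are dominated by a geometric series, which
  bounds \<open>f\<^sup>*(0+)\<close>, the essential supremum of \<open>f\<close> (\<open>dyadic_oscillation_bound\<close>).

  The exponents make sense because \<open>s > 0\<close>: were the doubling constant \<open>1\<close>, all balls about a point
  would have the same measure, and that point would be an atom.
\<close>

section \<open>Powers of extended nonnegative reals\<close>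

lemma ennreal_powr_ennreal: "0 \<le> y \<Longrightarrow> ennreal_powr (ennreal y) a = ennreal (y powr a)"
  by (simp add: ennreal_powr_def)

lemma ennreal_powr_mono:
  assumes "0 \<le> a" "x \<le> y"
  shows "ennreal_powr x a \<le> ennreal_powr y a"
proof (cases "y = \<infinity>")
  case False
  then have "x \<noteq> \<infinity>" using assms by (auto simp: top_unique)
  moreover have "enn2real x \<le> enn2real y"
    using assms False by (intro enn2real_mono) (auto simp: less_top)
  ultimately show ?thesis
    using assms False by (auto simp: ennreal_powr_def intro!: ennreal_leI powr_mono2)
qed (simp add: ennreal_powr_def)

text \<open>
  For a positive exponent this survives the convention \<open>0 * \<infinity> = 0\<close>, so averages can be
  cleared without distinguishing finite from infinite values.
\<close>

lemma ennreal_powr_mult: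
  assumes "0 < a"
  shows "ennreal_powr (x * y) a = ennreal_powr x a * ennreal_powr y a"
proof (cases "x = \<infinity> \<or> y = \<infinity>")
  case True
  have top: "ennreal_powr z a = 0 \<longleftrightarrow> z = 0" for z
    using assms by (cases z) (auto simp: ennreal_powr_def)
  show ?thesis
  proof (cases "x = 0 \<or> y = 0")
    case True
    have "ennreal_powr 0 a = 0" using top by simp
    with True show ?thesis by auto
  next
    case False
    then have "x * y = \<infinity>" "ennreal_powr x a * ennreal_powr y a = \<infinity>"
      using \<open>x = \<infinity> \<or> y = \<infinity>\<close> top[of x] top[of y]
      by (auto simp: ennreal_mult_eq_top_iff ennreal_powr_def)
    then show ?thesis by (simp add: ennreal_powr_def)
  qed
next
  case False
  then obtain x' y' where "x = ennreal x'" "0 \<le> x'" "y = ennreal y'" "0 \<le> y'"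
    by (metis ennreal_cases infinity_ennreal_def)
  then show ?thesis
    by (simp add: ennreal_powr_ennreal powr_mult flip: ennreal_mult)
qed

lemma borel_measurable_ennreal_powr [measurable]:
  "(\<lambda>x. ennreal_powr x a) \<in> borel_measurable borel"
  unfolding ennreal_powr_def by measurable

section \<open>Rearrangements\<close>

lemma rearrangement_antimono: "t \<le> u \<Longrightarrow> rearrangement M h u \<le> rearrangement M h t"
  unfolding rearrangement_def
  by (intro Inf_superset_mono Collect_mono impI) (meson ennreal_leI order_trans)

text \<open>
  The infimum that defines the rearrangement is attained, because the distribution function is
  continuous from the right: the set where \<open>h > y\<close> is an increasing union of such sets for larger
  \<open>y\<close>. The measurability and the distribution of the rearrangement are read off from this.
\<close>

lemma rearrangement_gt_iff:
  assumes [measurable]: "h \<in> borel_measurable M"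
  shows "y < rearrangement M h t \<longleftrightarrow> ennreal t < emeasure M {x\<in>space M. y < h x}"
proof (rule iffI)
  assume "y < rearrangement M h t"
  then show "ennreal t < emeasure M {x\<in>space M. y < h x}"
    unfolding rearrangement_def by (meson Inf_lower linorder_not_le mem_Collect_eq)
next
  assume lt: "ennreal t < emeasure M {x\<in>space M. y < h x}"
  show "y < rearrangement M h t"
  proof (rule ccontr)
    assume "\<not> y < rearrangement M h t"
    then have le: "rearrangement M h t \<le> y" by simp
    have "y \<noteq> \<infinity>" using lt by auto
    define z where "z n = y + ennreal (1 / Suc n)" for n
    have small: "emeasure M {x\<in>space M. z n < h x} \<le> ennreal t" for n
    proof -
      have "y < z n" using \<open>y \<noteq> \<infinity>\<close>
        by (cases y) (auto simp: z_def ennreal_less_iff simp flip: ennreal_plus)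
      with le have "rearrangement M h t < z n" by simp
      then obtain w where "w < z n" "emeasure M {x\<in>space M. w < h x} \<le> ennreal t"
        unfolding rearrangement_def by (auto simp: Inf_less_iff)
      moreover have "emeasure M {x\<in>space M. z n < h x} \<le> emeasure M {x\<in>space M. w < h x}"
        using \<open>w < z n\<close> by (intro emeasure_mono) auto
      ultimately show ?thesis by simp
    qed
    have "(\<lambda>n. z n) \<longlonglongrightarrow> y + ennreal 0"
      unfolding z_def using LIMSEQ_inverse_real_of_nat
      by (intro tendsto_add tendsto_const tendsto_ennrealI) (auto simp: inverse_eq_divide)
    then have "\<exists>n. z n < h x" if "y < h x" for x
      using that order_tendstoD(2)[of z y sequentially "h x"]
      by (auto simp: eventually_sequentially)
    moreover have "y \<le> z n" for n by (simp add: z_def)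
    ultimately have "{x\<in>space M. y < h x} = (\<Union>n. {x\<in>space M. z n < h x})"
      by (auto intro: le_less_trans)
    moreover have "incseq (\<lambda>n. {x\<in>space M. z n < h x})"
    proof (intro incseq_SucI subsetI)
      fix n x assume "x \<in> {x\<in>space M. z n < h x}"
      moreover have "z (Suc n) \<le> z n"
        unfolding z_def by (intro add_left_mono ennreal_leI) (auto simp: field_simps)
      ultimately show "x \<in> {x\<in>space M. z (Suc n) < h x}" by auto
    qed
    ultimately have "emeasure M {x\<in>space M. y < h x} = (SUP n. emeasure M {x\<in>space M. z n < h x})"
      by (subst SUP_emeasure_incseq) auto
    also have "\<dots> \<le> ennreal t" using small by (auto intro: SUP_least)
    finally show False using lt by simp
  qed
qed

lemma rearrangement_cong:
  assumes "\<And>y. emeasure M {x\<in>space M. y < h x} = emeasure M {x\<in>space M. y < k x}"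
  shows "rearrangement M h = rearrangement M k"
  using assms by (simp add: rearrangement_def fun_eq_iff)

lemma borel_measurable_rearrangement [measurable]:
  assumes "h \<in> borel_measurable M"
  shows "rearrangement M h \<in> borel_measurable borel"
  by (rule borel_measurableI_greater) (simp add: rearrangement_gt_iff[OF assms])

lemma emeasure_lborel_Ioo_below:
  assumes "0 \<le> t"
  shows "emeasure lborel {u\<in>{0<..<t}. ennreal u < m} = min m (ennreal t)"
proof (cases "m \<le> ennreal t")
  case True
  then obtain m' where m: "m = ennreal m'" "0 \<le> m'" by (cases m) (auto simp: top_unique)
  with True have "{u\<in>{0<..<t}. ennreal u < m} = {0<..<m'}"
    using assms by (auto simp: ennreal_less_iff)
  with m True show ?thesis by (simp add: min_def)
next
  case False
  then have "{u\<in>{0<..<t}. ennreal u < m} = {0<..<t}"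
    by (auto simp: not_le) (meson ennreal_leI less_imp_le le_less_trans)
  with assms False show ?thesis by (simp add: min_absorb2)
qed

text \<open>
  The level condition says that \<open>h\<close> on \<open>E\<close> and its rearrangement on \<open>(0, t)\<close> have the same
  distribution function. Both push forward to measures of the same finite mass \<open>t\<close>, and these agree
  on the rays \<open>{y<..}\<close>, which generate the Borel sets, hence they are equal.
\<close>

lemma nn_integral_rearrangement:
  assumes h [measurable]: "h \<in> borel_measurable M" and E [measurable]: "E \<in> sets M"
    and t: "emeasure M E = ennreal t" "0 \<le> t"
    and level: "\<And>y. emeasure M {x\<in>E. y < h x} = min (emeasure M {x\<in>space M. y < h x}) (ennreal t)"
    and f: "f \<in> borel_measurable borel"
  shows "(\<integral>\<^sup>+u\<in>{0<..<t}. f (rearrangement M h u) \<partial>lborel) = (\<integral>\<^sup>+x\<in>E. f (h x) \<partial>M)"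
proof -
  define A where "A = distr (restrict_space lborel {0<..<t}) borel (rearrangement M h)"
  define B where "B = distr (restrict_space M E) borel h"
  have mA [measurable]: "rearrangement M h \<in> borel_measurable (restrict_space lborel {0<..<t})"
    by (intro measurable_restrict_space1) simp
  have mB [measurable]: "h \<in> borel_measurable (restrict_space M E)"
    by (intro measurable_restrict_space1) simp
  have Esub: "E \<subseteq> space M" using E by (rule sets.sets_into_space)
  have spA: "space (restrict_space lborel {0<..<t}) = {0<..<t}"
    by (simp add: space_restrict_space)
  have spB: "space (restrict_space M E) = E"
    using Esub by (auto simp: space_restrict_space)
  have eqA: "emeasure A {y<..} = min (emeasure M {x\<in>space M. y < h x}) (ennreal t)" for y
  proof -
    have "emeasure A {y<..} = emeasure (restrict_space lborel {0<..<t})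
            (rearrangement M h -` {y<..} \<inter> {0<..<t})"
      unfolding A_def by (subst emeasure_distr) (auto simp: spA)
    also have "\<dots> = emeasure lborel (rearrangement M h -` {y<..} \<inter> {0<..<t})"
      by (subst emeasure_restrict_space) auto
    also have "rearrangement M h -` {y<..} \<inter> {0<..<t}
        = {u\<in>{0<..<t}. ennreal u < emeasure M {x\<in>space M. y < h x}}"
      by (auto simp: rearrangement_gt_iff[OF h])
    also have "emeasure lborel \<dots> = min (emeasure M {x\<in>space M. y < h x}) (ennreal t)"
      using t(2) by (rule emeasure_lborel_Ioo_below)
    finally show ?thesis .
  qed
  have eqB: "emeasure B {y<..} = min (emeasure M {x\<in>space M. y < h x}) (ennreal t)" for y
  proof -
    have "emeasure B {y<..} = emeasure (restrict_space M E) (h -` {y<..} \<inter> E)"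
      unfolding B_def by (subst emeasure_distr) (auto simp: spB)
    also have "\<dots> = emeasure M (h -` {y<..} \<inter> E)"
      using E Esub by (subst emeasure_restrict_space) (auto simp: Int_absorb1)
    also have "h -` {y<..} \<inter> E = {x\<in>E. y < h x}" by auto
    finally show ?thesis by (simp add: level)
  qed
  have tA: "emeasure A UNIV = ennreal t"
    unfolding A_def using t by (subst emeasure_distr) (auto simp: spA emeasure_restrict_space)
  have tB: "emeasure B UNIV = ennreal t"
    unfolding B_def using t E Esub
    by (subst emeasure_distr) (auto simp: spB emeasure_restrict_space Int_absorb1)
  \<comment> \<open>The rays do not cover the value \<open>0\<close>, hence the additional generator \<open>UNIV\<close>.\<close>
  have gen: "sets (borel :: ennreal measure) = sigma_sets UNIV (insert UNIV (range greaterThan))"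
  proof -
    have "sets (borel :: ennreal measure) = sigma_sets UNIV (range greaterThan)"
      by (simp add: borel_Ioi)
    also have "\<dots> = sigma_sets UNIV (insert UNIV (range greaterThan))"
      by (rule sigma_sets_eqI) (auto intro: sigma_sets_top)
    finally show ?thesis .
  qed
  have "A = B"
  proof (rule measure_eqI_generator_eq)
    show "Int_stable (insert UNIV (range greaterThan) :: ennreal set set)"
    proof -
      have "{a<..} \<inter> {b<..} = {max a b<..}" for a b :: ennreal by auto
      then have "{a<..} \<inter> {b<..} \<in> range greaterThan" for a b :: ennreal by simp
      then show ?thesis by (intro Int_stableI) (elim insertE rangeE; simp)
    qed
    show "range (\<lambda>_::nat. UNIV) \<subseteq> insert UNIV (range greaterThan)" by auto
    show "sets A = sigma_sets UNIV (insert UNIV (range greaterThan))"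
      "sets B = sigma_sets UNIV (insert UNIV (range greaterThan))"
      by (auto simp: A_def B_def gen)
  qed (auto simp: eqA eqB tA tB)
  have "(\<integral>\<^sup>+u\<in>{0<..<t}. f (rearrangement M h u) \<partial>lborel)
      = (\<integral>\<^sup>+u. f (rearrangement M h u) \<partial>restrict_space lborel {0<..<t})"
    by (subst nn_integral_restrict_space) auto
  also have "\<dots> = (\<integral>\<^sup>+y. f y \<partial>A)"
    unfolding A_def using f by (subst nn_integral_distr) auto
  also have "\<dots> = (\<integral>\<^sup>+y. f y \<partial>B)" by (simp only: \<open>A = B\<close>)
  also have "\<dots> = (\<integral>\<^sup>+x. f (h x) \<partial>restrict_space M E)"
    unfolding B_def using f by (subst nn_integral_distr) auto
  also have "\<dots> = (\<integral>\<^sup>+x\<in>E. f (h x) \<partial>M)"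
    using E Esub by (subst nn_integral_restrict_space) (auto simp: Int_absorb1)
  finally show ?thesis .
qed

section \<open>Subsets of prescribed measure\<close>

text \<open>
  Of a proper subset of positive measure and its complement, one has at most half the measure.
\<close>

lemma nonatomic_halve:
  assumes "nonatomic M" and A: "A \<in> fmeasurable M" and pos: "0 < measure M A"
  obtains B where "B \<in> sets M" "B \<subseteq> A" "0 < measure M B" "measure M B \<le> measure M A / 2"
proof -
  have eA: "emeasure M A = ennreal (measure M A)"
    using A by (simp add: emeasure_eq_measure2)
  with assms obtain B where B: "B \<in> sets M" "B \<subseteq> A" "0 < emeasure M B" "emeasure M B < emeasure M A"
    unfolding nonatomic_def by (metis ennreal_less_zero_iff fmeasurableD)
  have fB: "B \<in> fmeasurable M" using A B by (meson fmeasurableI2)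
  then have eB: "emeasure M B = ennreal (measure M B)" by (simp add: emeasure_eq_measure2)
  have m: "0 < measure M B" "measure M B < measure M A"
    using B(3,4) eA eB by (auto simp: ennreal_less_iff)
  have d: "measure M (A - B) = measure M A - measure M B"
    using A B fB by (intro measure_Diff) (auto dest: fmeasurableD2)
  show thesis
  proof (cases "measure M B \<le> measure M A / 2")
    case True
    with B m that show ?thesis by blast
  next
    case False
    with B m d A that[of "A - B"] show ?thesis by (auto dest: fmeasurableD)
  qed
qed

lemma nonatomic_small_subset:
  assumes "nonatomic M" and A: "A \<in> fmeasurable M" and pos: "0 < measure M A" and e: "0 < e"
  obtains B where "B \<in> sets M" "B \<subseteq> A" "0 < measure M B" "measure M B \<le> e"
proof -
  have step: "\<exists>B\<in>sets M. B \<subseteq> A \<and> 0 < measure M B \<and> measure M B \<le> measure M A / 2 ^ n" for n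
  proof (induction n)
    case 0
    then show ?case using A pos by (auto dest: fmeasurableD)
  next
    case (Suc n)
    then obtain B where B: "B \<in> sets M" "B \<subseteq> A" "0 < measure M B" "measure M B \<le> measure M A / 2 ^ n"
      by blast
    have "B \<in> fmeasurable M" using A B by (meson fmeasurableI2)
    from nonatomic_halve[OF assms(1) this B(3)] obtain C
      where "C \<in> sets M" "C \<subseteq> B" "0 < measure M C" "measure M C \<le> measure M B / 2" by blast
    moreover have "measure M B / 2 \<le> measure M A / 2 ^ Suc n" using B(4) by simp
    ultimately show ?case using B(2) by (intro bexI[of _ C] conjI) (blast | linarith)+
  qed
  have "(\<lambda>n. measure M A / 2 ^ n) \<longlonglongrightarrow> 0"
    by (intro LIMSEQ_divide_realpow_zero) auto
  with e obtain n where "measure M A / 2 ^ n < e"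
    by (metis (no_types, lifting) eventually_sequentially le_refl order_tendstoD(2))
  with step[of n] that show ?thesis by force
qed

text \<open>
  Sierpinski's theorem on the range of a nonatomic measure. The set is exhausted greedily: each step
  adds a piece of at least half the supremum of the measures that still fit below \<open>t\<close>. The pieces have
  summable measures, so their measures tend to zero. If the union had measure less than \<open>t\<close>, a small
  subset of the remainder would fit at every step and force all pieces to be at least half as large,
  a contradiction.
\<close>

lemma nonatomic_subset_of_measure:
  assumes na: "nonatomic M" and A: "A \<in> fmeasurable M" and t: "0 \<le> t" "t \<le> measure M A"
  obtains B where "B \<in> sets M" "B \<subseteq> A" "measure M B = t"
proof -
  define P where "P B \<longleftrightarrow> B \<in> sets M \<and> B \<subseteq> A \<and> measure M B \<le> t" for B
  define feas where "feas B = {C\<in>sets M. C \<subseteq> A - B \<and> measure M B + measure M C \<le> t}" for B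
  define Q where "Q B B' \<longleftrightarrow> B \<subseteq> B' \<and>
    (\<forall>C\<in>feas B. measure M C \<le> 2 * (measure M B' - measure M B))" for B B'
  have fm: "B \<in> fmeasurable M" if "B \<in> sets M" "B \<subseteq> A" for B
    using A that by (meson fmeasurableI2)
  have step: "\<exists>B'. P B' \<and> Q B B'" if "P B" for B
  proof -
    have B: "B \<in> sets M" "B \<subseteq> A" "measure M B \<le> t" using that by (auto simp: P_def)
    define S where "S = Sup (measure M ` feas B)"
    have bdd: "bdd_above (measure M ` feas B)"
    proof (rule bdd_aboveI[of _ t])
      fix a assume "a \<in> measure M ` feas B"
      then obtain C where "a = measure M C" "measure M B + measure M C \<le> t"
        by (auto simp: feas_def)
      then show "a \<le> t" using measure_nonneg[of M B] by linarith
    qed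
    have ne: "{} \<in> feas B" using B by (auto simp: feas_def)
    have up: "measure M C \<le> S" if "C \<in> feas B" for C
      unfolding S_def using that bdd by (intro cSup_upper) auto
    have "\<exists>C\<in>feas B. S \<le> 2 * measure M C"
    proof (cases "S \<le> 0")
      case True
      with ne show ?thesis by (intro bexI[of _ "{}"]) auto
    next
      case False
      then have "S / 2 < S" by simp
      then obtain C where "C \<in> feas B" "S / 2 < measure M C"
        using less_cSup_iff[OF _ bdd, of "S / 2"] ne unfolding S_def by auto
      then show ?thesis by (intro bexI[of _ C]) auto
    qed
    then obtain C where C: "C \<in> feas B" "S \<le> 2 * measure M C" by blast
    then have C': "C \<in> sets M" "C \<subseteq> A - B" "measure M B + measure M C \<le> t"
      by (auto simp: feas_def)
    have "C \<subseteq> A" using C'(2) by blast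
    then have un: "measure M (B \<union> C) = measure M B + measure M C"
      using fmeasurableD2[OF fm[OF B(1,2)]] fmeasurableD2[OF fm[OF C'(1)]] B(1) C'(1,2)
      by (intro measure_Union) auto
    have "P (B \<union> C)" using B C' un by (auto simp: P_def)
    moreover have "Q B (B \<union> C)"
      unfolding Q_def un using C(2) by (auto dest: up)
    ultimately show ?thesis by blast
  qed
  have "P {}" using t by (simp add: P_def)
  with step have "\<exists>B. \<forall>n. P (B n) \<and> Q (B n) (B (Suc n))"
    by (intro dependent_nat_choice[of "\<lambda>_. P" "\<lambda>_. Q"]) blast+
  then obtain B where B: "\<And>n. P (B n)" "\<And>n. Q (B n) (B (Suc n))" by blast
  define U where "U = (\<Union>n. B n)"
  have Bs: "B n \<in> sets M" "B n \<subseteq> A" "measure M (B n) \<le> t" for n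
    using B(1) by (auto simp: P_def)
  have U: "U \<in> sets M" "U \<subseteq> A" unfolding U_def using Bs by auto
  have lim: "(\<lambda>n. measure M (B n)) \<longlonglongrightarrow> measure M U"
    unfolding U_def
  proof (rule Lim_measure_incseq)
    show "range B \<subseteq> sets M" using Bs(1) by auto
    show "incseq B" using B(2) by (intro incseq_SucI) (auto simp: Q_def)
    show "emeasure M (\<Union>n. B n) \<noteq> \<infinity>"
      using fmeasurableD2[OF fm[OF U]] by (simp add: U_def)
  qed
  then have "measure M U \<le> t" using Bs(3) by (intro LIMSEQ_le_const2) auto
  moreover have "\<not> measure M U < t"
  proof
    assume less: "measure M U < t"
    have "measure M (A - U) = measure M A - measure M U"
      using fmeasurableD2[OF A] U A by (intro measure_Diff) auto
    then have "0 < measure M (A - U)" using less t by simp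
    moreover have "A - U \<in> fmeasurable M" using A U by (intro fmeasurable_Diff) auto
    ultimately obtain D where D: "D \<in> sets M" "D \<subseteq> A - U" "0 < measure M D" "measure M D \<le> t - measure M U"
      using nonatomic_small_subset[OF na, of "A - U" "t - measure M U"] less by auto
    have "D \<in> feas (B n)" for n
    proof -
      have "measure M (B n) \<le> measure M U"
        using Bs(1) fm[OF U] by (intro measure_mono_fmeasurable) (auto simp: U_def)
      with D show ?thesis by (auto simp: feas_def U_def)
    qed
    then have "measure M D \<le> 2 * (measure M (B (Suc n)) - measure M (B n))" for n
      using B(2)[of n] by (auto simp: Q_def)
    moreover have "(\<lambda>n. 2 * (measure M (B (Suc n)) - measure M (B n))) \<longlonglongrightarrow> 2 * (measure M U - measure M U)"
      by (intro tendsto_intros lim LIMSEQ_Suc)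
    ultimately have "measure M D \<le> 2 * (measure M U - measure M U)"
      by (intro LIMSEQ_le_const) auto
    with D show False by simp
  qed
  ultimately show thesis using U that by force
qed

lemma nonatomic_between_of_measure:
  assumes "nonatomic M" and A: "A \<in> fmeasurable M" and B: "B \<in> sets M" "B \<subseteq> A"
    and t: "measure M B \<le> t" "t \<le> measure M A"
  obtains C where "C \<in> sets M" "B \<subseteq> C" "C \<subseteq> A" "measure M C = t"
proof -
  have fB: "B \<in> fmeasurable M" using A B by (meson fmeasurableI2)
  have "measure M (A - B) = measure M A - measure M B"
    using A B fB by (intro measure_Diff) (auto dest: fmeasurableD2)
  then obtain D where D: "D \<in> sets M" "D \<subseteq> A - B" "measure M D = t - measure M B"
    using nonatomic_subset_of_measure[OF assms(1), of "A - B" "t - measure M B"] A fB t by auto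
  then have "D \<in> fmeasurable M" using A by (meson Diff_subset fmeasurableI2 order_trans)
  then have "measure M (B \<union> D) = measure M B + measure M D"
    using B D fB by (intro measure_Union) (auto dest: fmeasurableD2)
  with B D that[of "B \<union> D"] show thesis by auto
qed

lemma nonatomic_disjoint_family:
  assumes na: "nonatomic M" and "finite I" and "E \<in> fmeasurable M"
    and "\<And>i. i \<in> I \<Longrightarrow> 0 \<le> m i" and "sum m I \<le> measure M E"
  shows "\<exists>A. disjoint_family_on A I \<and>
    (\<forall>i\<in>I. A i \<in> sets M \<and> A i \<subseteq> E \<and> measure M (A i) = m i)"
  using assms(2-)
proof (induction I arbitrary: E rule: finite_induct)
  case empty
  then show ?case by (auto simp: disjoint_family_on_def)
next
  case (insert i I)
  have "0 \<le> sum m I" using insert by (intro sum_nonneg) auto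
  then have "0 \<le> m i" "m i \<le> measure M E" using insert by auto
  then obtain D where D: "D \<in> sets M" "D \<subseteq> E" "measure M D = m i"
    using nonatomic_subset_of_measure[OF na insert.prems(1)] by metis
  then have fD: "D \<in> fmeasurable M" using insert.prems(1) by (meson fmeasurableI2)
  have "measure M (E - D) = measure M E - m i"
    using insert.prems(1) D fD by (subst measure_Diff) (auto dest: fmeasurableD2)
  then obtain A where A: "disjoint_family_on A I"
      "\<forall>j\<in>I. A j \<in> sets M \<and> A j \<subseteq> E - D \<and> measure M (A j) = m j"
    using insert.IH[of "E - D"] insert.prems insert.hyps fD by auto
  have "disjoint_family_on (A(i := D)) (insert i I)"
    using A insert.hyps unfolding disjoint_family_on_def by auto
  moreover have "\<forall>j\<in>insert i I. (A(i := D)) j \<in> sets M \<and> (A(i := D)) j \<subseteq> E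
      \<and> measure M ((A(i := D)) j) = m j"
    using A D insert.hyps by auto
  ultimately show ?case by blast
qed

section \<open>Level sets\<close>

text \<open>
  Let \<open>a\<close> be the rearrangement of \<open>h\<close> at \<open>t\<close>. The set where \<open>h > a\<close> has measure at most \<open>t\<close>, the
  set where \<open>h \<ge> a\<close> (inside \<open>W\<close>) has measure at least \<open>t\<close>, and any set \<open>E\<close> of measure
  \<open>t\<close> between the two contains each higher level set of \<open>h\<close> and is contained in each lower one. Cutting down to \<open>W\<close>
  keeps the measures finite, also if \<open>a = 0\<close>, when \<open>h \<ge> a\<close> holds everywhere.
\<close>

lemma nonatomic_level_set:
  fixes h :: "'a \<Rightarrow> ennreal"
  assumes na: "nonatomic M" and h [measurable]: "h \<in> borel_measurable M"
    and W: "W \<in> fmeasurable M" "\<And>x. x \<in> space M - W \<Longrightarrow> h x = 0"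
    and t: "0 \<le> t" "t \<le> measure M W"
  obtains E where "E \<in> sets M" "emeasure M E = ennreal t"
    "\<And>y. emeasure M {x\<in>E. y < h x} = min (emeasure M {x\<in>space M. y < h x}) (ennreal t)"
proof -
  define a where "a = rearrangement M h t"
  have [measurable]: "W \<in> sets M" using W by auto
  have Wsub: "W \<subseteq> space M" by (rule sets.sets_into_space) simp
  have inW: "{x\<in>space M. y < h x} = {x\<in>W. y < h x}" for y
    using W(2) Wsub by (auto simp: not_less) force
  define A where "A = {x\<in>W. a \<le> h x}"
  define B where "B = {x\<in>W. a < h x}"
  have A [measurable]: "A \<in> sets M" and B [measurable]: "B \<in> sets M"
    unfolding A_def B_def by measurable
  have fA: "A \<in> fmeasurable M" and fB: "B \<in> fmeasurable M"
    using W(1) A B by (auto simp: A_def B_def intro: fmeasurableI2)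
  have "\<not> a < rearrangement M h t" by (simp add: a_def)
  then have "emeasure M B \<le> ennreal t"
    unfolding B_def using inW by (simp add: rearrangement_gt_iff[OF h] not_less)
  then have Bt: "measure M B \<le> t"
    using fB t by (simp add: emeasure_eq_measure2)
  have At: "t \<le> measure M A"
  proof (cases "a = 0")
    case True
    with t show ?thesis by (simp add: A_def)
  next
    case False
    then have "0 < a" by (simp add: zero_less_iff_neq_zero)
    then obtain z :: "nat \<Rightarrow> ennreal" where z: "incseq z" "range z \<subseteq> {..<a}" "Sup {..<a} = (SUP n. z n)"
      using ennreal_Sup_countable_SUP[of "{..<a}"] by auto
    then have z: "incseq z" "\<And>n. z n < a" "z \<longlonglongrightarrow> a"
      using LIMSEQ_SUP[of z] by auto
    have "A = (\<Inter>n. {x\<in>W. z n < h x})"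
    proof (intro set_eqI iffI)
      fix x assume "x \<in> (\<Inter>n. {x\<in>W. z n < h x})"
      then have "x \<in> W" "\<And>n. z n \<le> h x" by (auto intro: less_imp_le)
      then show "x \<in> A" using LIMSEQ_le_const2[OF z(3), of "h x"] by (auto simp: A_def)
    qed (use z(2) in \<open>auto simp: A_def intro: less_le_trans\<close>)
    moreover have "decseq (\<lambda>n. {x\<in>W. z n < h x})"
      using z(1) by (auto simp: decseq_def incseq_def intro: le_less_trans)
    ultimately have "(\<lambda>n. measure M {x\<in>W. z n < h x}) \<longlonglongrightarrow> measure M A"
      using fmeasurableD2[OF fmeasurableI2[OF W(1)]] by (auto intro!: Lim_measure_decseq)
    moreover have "t \<le> measure M {x\<in>W. z n < h x}" for n
    proof -
      have "ennreal t < emeasure M {x\<in>W. z n < h x}"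
        using z(2)[of n] by (simp add: a_def rearrangement_gt_iff[OF h] inW)
      moreover have "{x\<in>W. z n < h x} \<in> fmeasurable M"
        using W(1) by (rule fmeasurableI2) auto
      ultimately show ?thesis using t
        by (simp add: emeasure_eq_measure2 ennreal_less_iff)
    qed
    ultimately show ?thesis by (intro LIMSEQ_le_const) auto
  qed
  have "B \<subseteq> A" by (auto simp: A_def B_def)
  then obtain E where E: "E \<in> sets M" "B \<subseteq> E" "E \<subseteq> A" "measure M E = t"
    using nonatomic_between_of_measure[OF na fA B _ Bt At] by blast
  then have emE: "emeasure M E = ennreal t"
    using fA by (metis emeasure_eq_measure2 fmeasurableI2)
  show thesis
  proof (rule that[OF E(1) emE])
    fix y
    show "emeasure M {x\<in>E. y < h x} = min (emeasure M {x\<in>space M. y < h x}) (ennreal t)"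
    proof (cases "a \<le> y")
      case True
      then have eq: "{x\<in>space M. y < h x} = {x\<in>E. y < h x}"
        using E Wsub unfolding inW by (auto simp: A_def B_def)
      have "emeasure M {x\<in>E. y < h x} \<le> emeasure M E" using E by (intro emeasure_mono) auto
      with eq emE show ?thesis by (simp add: min_absorb1)
    next
      case False
      then have eq: "{x\<in>E. y < h x} = E" using E by (auto simp: A_def not_le)
      have "emeasure M E \<le> emeasure M {x\<in>space M. y < h x}"
        using False E Wsub by (intro emeasure_mono) (auto simp: A_def not_le)
      with eq emE show ?thesis by (simp add: min_absorb2)
    qed
  qed
qed

section \<open>The associate norm of an indicator\<close>

text \<open>
  A simple function presented by its level sets: for a disjoint family \<open>A\<close>, the value on \<open>A v\<close> is
  \<open>v\<close>. Replacing the level sets by others of the same measures then visibly preserves the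
  distribution.
\<close>

definition step_function :: "ennreal set \<Rightarrow> (ennreal \<Rightarrow> 'a set) \<Rightarrow> 'a \<Rightarrow> ennreal" where
  "step_function V A x = (\<Sum>v\<in>V. v * indicator (A v) x)"

lemma step_function_eq:
  assumes "finite V" "disjoint_family_on A V" "v \<in> V" "x \<in> A v"
  shows "step_function V A x = v"
proof -
  have "step_function V A x = (\<Sum>w\<in>V. if w = v then v else 0)"
    unfolding step_function_def
    using assms by (intro sum.cong) (auto simp: disjoint_family_on_def split: split_indicator)
  with assms show ?thesis by simp
qed

lemma step_function_eq_0: "(\<And>v. v \<in> V \<Longrightarrow> x \<notin> A v) \<Longrightarrow> step_function V A x = 0"
  by (simp add: step_function_def)

lemma emeasure_step_function_gt:
  assumes V: "finite V" "disjoint_family_on A V" "\<And>v. v \<in> V \<Longrightarrow> A v \<in> sets M"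
  shows "emeasure M {x\<in>space M. y < step_function V A x} = (\<Sum>v\<in>{v\<in>V. y < v}. emeasure M (A v))"
proof -
  have "{x\<in>space M. y < step_function V A x} = (\<Union>v\<in>{v\<in>V. y < v}. A v)" (is "?L = ?R")
  proof (intro set_eqI iffI)
    fix x assume x: "x \<in> ?L"
    then have "step_function V A x \<noteq> 0" by auto
    then obtain v where v: "v \<in> V" "x \<in> A v" using step_function_eq_0 by metis
    with x step_function_eq[OF V(1,2) v] show "x \<in> ?R" by auto
  next
    fix x assume "x \<in> ?R"
    then obtain v where v: "v \<in> V" "x \<in> A v" "y < v" by auto
    with step_function_eq[OF V(1,2) v(1,2)] sets.sets_into_space[OF V(3)] show "x \<in> ?L" by auto
  qed
  moreover have "disjoint_family_on A {v\<in>V. y < v}"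
    using V(2) by (rule disjoint_family_on_mono[rotated]) auto
  ultimately show ?thesis
    using V by (subst sum_emeasure) auto
qed

lemma nn_integral_step_function:
  assumes "\<And>v. v \<in> V \<Longrightarrow> A v \<in> sets M"
  shows "(\<integral>\<^sup>+x. step_function V A x \<partial>M) = (\<Sum>v\<in>V. v * emeasure M (A v))"
  unfolding step_function_def using assms
  by (subst nn_integral_sum) (auto intro!: sum.cong simp: nn_integral_cmult_indicator)

lemma borel_measurable_step_function:
  assumes "\<And>v. v \<in> V \<Longrightarrow> A v \<in> sets M"
  shows "step_function V A \<in> borel_measurable M"
proof -
  have [measurable]: "(\<lambda>x. v * indicator (A v) x) \<in> borel_measurable M" if "v \<in> V" for v
    using assms[OF that] by measurable
  show ?thesis unfolding step_function_def by measurable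
qed

text \<open>
  An equimeasurable copy on \<open>F\<close> of a simple function on \<open>E\<close>: its level sets are moved to disjoint
  subsets of \<open>F\<close> of the same measures.
\<close>

lemma simple_function_transport:
  assumes na: "nonatomic M" and E: "E \<in> fmeasurable M" and F: "F \<in> fmeasurable M"
    and eq: "measure M E = measure M F"
    and h: "simple_function M h" "\<And>x. h x < top"
  obtains k where "k \<in> borel_measurable M" "\<And>x. k x < top" "\<And>x. x \<notin> F \<Longrightarrow> k x = 0"
    "rearrangement M k = rearrangement M (\<lambda>x. h x * indicator E x)"
    "(\<integral>\<^sup>+x. k x \<partial>M) = (\<integral>\<^sup>+x\<in>E. h x \<partial>M)"
proof -
  define V where "V = h ` space M"
  define A where "A v = {x\<in>E. h x = v}" for v
  have [measurable]: "h \<in> borel_measurable M" using h(1) by (rule borel_measurable_simple_function)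
  have E' [measurable]: "E \<in> sets M" using E by auto
  have Esub: "E \<subseteq> space M" by (rule sets.sets_into_space) simp
  have finV: "finite V" using h(1) by (auto simp: V_def simple_function_def)
  have A: "A v \<in> sets M" for v unfolding A_def by measurable
  have fA: "A v \<in> fmeasurable M" for v
    using fmeasurableI2[OF E _ A] by (auto simp: A_def)
  have disA: "disjoint_family_on A V" by (auto simp: disjoint_family_on_def A_def)
  have "(\<Union>v\<in>V. A v) = E" using Esub by (auto simp: A_def V_def)
  then have "(\<Sum>v\<in>V. measure M (A v)) = measure M E"
    using measure_finite_Union[OF finV _ disA, of M] A fmeasurableD2[OF fA] by (auto simp: image_subset_iff)
  then obtain B where B: "disjoint_family_on B V"
      "\<forall>v\<in>V. B v \<in> sets M \<and> B v \<subseteq> F \<and> measure M (B v) = measure M (A v)"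
    using nonatomic_disjoint_family[OF na finV F, of "\<lambda>v. measure M (A v)"] eq by auto
  have emB: "emeasure M (B v) = emeasure M (A v)" if "v \<in> V" for v
  proof -
    have "B v \<in> fmeasurable M" using B that F by (meson fmeasurableI2)
    with fA[of v] B that show ?thesis by (simp add: emeasure_eq_measure2)
  qed
  have hE: "(\<lambda>x. h x * indicator E x) = step_function V A"
  proof
    fix x
    show "h x * indicator E x = step_function V A x"
    proof (cases "x \<in> E")
      case True
      then have "h x \<in> V" "x \<in> A (h x)" using Esub by (auto simp: V_def A_def)
      with True step_function_eq[OF finV disA] show ?thesis by simp
    next
      case False
      then have "step_function V A x = 0" by (intro step_function_eq_0) (auto simp: A_def)
      with False show ?thesis by simp
    qed
  qed
  show thesis
  proof (rule that[of "step_function V B"])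
    show "step_function V B \<in> borel_measurable M"
      using B(2) by (intro borel_measurable_step_function) auto
    have "v < top" if "v \<in> V" for v using that h(2) by (auto simp: V_def)
    then show "step_function V B x < top" for x
      unfolding step_function_def ennreal_sum_less_top[OF finV]
      by (auto simp: ennreal_mult_less_top split: split_indicator)
    show "step_function V B x = 0" if "x \<notin> F" for x
      using that B(2) by (intro step_function_eq_0) auto
    show "rearrangement M (step_function V B) = rearrangement M (\<lambda>x. h x * indicator E x)"
      unfolding hE using B finV disA A emB
      by (intro rearrangement_cong) (simp add: emeasure_step_function_gt)
    have "(\<integral>\<^sup>+x. step_function V B x \<partial>M) = (\<integral>\<^sup>+x. step_function V A x \<partial>M)"
      using A B emB by (simp add: nn_integral_step_function)
    then show "(\<integral>\<^sup>+x. step_function V B x \<partial>M) = (\<integral>\<^sup>+x\<in>E. h x \<partial>M)"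
      by (simp flip: hE)
  qed
qed

lemma ri_norm_mono:
  assumes "ri_norm M \<rho>" "h \<in> borel_measurable M" "k \<in> borel_measurable M" "\<And>x. h x \<le> k x"
  shows "\<rho> h \<le> \<rho> k"
  using assms unfolding ri_norm_def banach_function_norm_def by auto

text \<open>
  Rearrangement invariance is a condition on real functions of finite norm; this is the form that it
  takes for functions with values in \<open>[0, \<infinity>]\<close>.
\<close>

lemma ri_norm_equimeasurable:
  assumes "ri_norm M \<rho>" and [measurable]: "h \<in> borel_measurable M" "k \<in> borel_measurable M"
    and fin: "\<And>x. h x < top" "\<And>x. k x < top" "\<rho> h < \<infinity>"
    and eq: "rearrangement M k = rearrangement M h"
  shows "\<rho> k = \<rho> h"
proof -
  have h: "(\<lambda>x. ennreal \<bar>enn2real (h x)\<bar>) = h" and k: "(\<lambda>x. ennreal \<bar>enn2real (k x)\<bar>) = k"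
    using fin by (auto simp: fun_eq_iff)
  have hs: "(\<lambda>x. enn2real (h x)) \<in> function_space M \<rho>"
    unfolding function_space_def mem_Collect_eq h using fin(3) by (intro conjI) measurable
  have km: "(\<lambda>x. enn2real (k x)) \<in> borel_measurable M" by measurable
  have "\<forall>f\<in>function_space M \<rho>. \<forall>g\<in>borel_measurable M.
      rearrangement M (\<lambda>x. ennreal \<bar>g x\<bar>) = rearrangement M (\<lambda>x. ennreal \<bar>f x\<bar>) \<longrightarrow>
      g \<in> function_space M \<rho> \<and> \<rho> (\<lambda>x. ennreal \<bar>g x\<bar>) = \<rho> (\<lambda>x. ennreal \<bar>f x\<bar>)"
    using assms(1) unfolding ri_norm_def by (rule conjunct2)
  from bspec[OF bspec[OF this hs] km] eq show ?thesis unfolding h k by blast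
qed

lemma associate_norm_upper:
  assumes "h \<in> borel_measurable M" "\<rho> h \<le> 1"
  shows "(\<integral>\<^sup>+x. h x * k x \<partial>M) \<le> associate_norm M \<rho> k"
  unfolding associate_norm_def using assms by (intro SUP_upper) auto

text \<open>
  By symmetry, the associate norm of an indicator depends on the measure of the set only. A
  competitor \<open>h\<close> for \<open>E\<close> is approximated from below by simple functions on \<open>E\<close>; their equimeasurable
  copies on \<open>F\<close> have the same integral and, by rearrangement invariance, the same norm, hence are
  competitors for \<open>F\<close>.
\<close>

lemma associate_norm_indicator_le:
  assumes na: "nonatomic M" and ri: "ri_norm M \<rho>"
    and E: "E \<in> fmeasurable M" and F: "F \<in> fmeasurable M"
    and eq: "measure M E = measure M F"
  shows "associate_norm M \<rho> (indicator E) \<le> associate_norm M \<rho> (indicator F)"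
  unfolding associate_norm_def [of M \<rho> "indicator E"]
proof (rule SUP_least)
  fix h assume "h \<in> {h\<in>borel_measurable M. \<rho> h \<le> 1}"
  then have h [measurable]: "h \<in> borel_measurable M" and "\<rho> h \<le> 1" by auto
  have [measurable]: "E \<in> sets M" using E by auto
  obtain s where s: "\<And>i. simple_function M (s i)" "incseq s" "\<And>i x. s i x < top"
      "\<And>x. (SUP i. s i x) = h x"
    using borel_measurable_implies_simple_function_sequence'[OF h] by blast
  have [measurable]: "s i \<in> borel_measurable M" for i
    by (rule borel_measurable_simple_function[OF s(1)])
  have le: "(\<integral>\<^sup>+x\<in>E. s i x \<partial>M) \<le> associate_norm M \<rho> (indicator F)" for i
  proof -
    obtain k where k: "k \<in> borel_measurable M" "\<And>x. k x < top" "\<And>x. x \<notin> F \<Longrightarrow> k x = 0"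
        "rearrangement M k = rearrangement M (\<lambda>x. s i x * indicator E x)"
        "(\<integral>\<^sup>+x. k x \<partial>M) = (\<integral>\<^sup>+x\<in>E. s i x \<partial>M)"
      by (rule simple_function_transport[OF na E F eq s(1)[of i] s(3)[of i]]) (rule that; assumption)
    have "s i x \<le> h x" for x using s(4)[of x] by (metis SUP_upper UNIV_I)
    then have "\<rho> (\<lambda>x. s i x * indicator E x) \<le> \<rho> h"
      by (intro ri_norm_mono[OF ri]) (auto split: split_indicator)
    with \<open>\<rho> h \<le> 1\<close> have le1: "\<rho> (\<lambda>x. s i x * indicator E x) \<le> 1" by simp
    then have "\<rho> (\<lambda>x. s i x * indicator E x) < \<infinity>"
      by (metis ennreal_one_less_top infinity_ennreal_def le_less_trans)
    then have "\<rho> k = \<rho> (\<lambda>x. s i x * indicator E x)"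
      using k s(3) by (intro ri_norm_equimeasurable[OF ri]) (auto split: split_indicator)
    with le1 k(1) have "(\<integral>\<^sup>+x. k x * indicator F x \<partial>M) \<le> associate_norm M \<rho> (indicator F)"
      by (intro associate_norm_upper) auto
    moreover have "(\<lambda>x. k x * indicator F x) = k"
      using k(3) by (auto split: split_indicator)
    ultimately show ?thesis by (simp add: k(5))
  qed
  have "(\<integral>\<^sup>+x. h x * indicator E x \<partial>M) = (\<integral>\<^sup>+x. (SUP i. s i x * indicator E x) \<partial>M)"
    by (intro nn_integral_cong) (simp add: s(4)[symmetric] SUP_mult_right_ennreal)
  also have "\<dots> = (SUP i. \<integral>\<^sup>+x. s i x * indicator E x \<partial>M)"
    using s(2) by (intro nn_integral_monotone_convergence_SUP)
      (auto simp: incseq_def le_fun_def intro!: mult_right_mono)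
  also have "\<dots> \<le> associate_norm M \<rho> (indicator F)" using le by (rule SUP_least)
  finally show "(\<integral>\<^sup>+x. h x * indicator E x \<partial>M) \<le> associate_norm M \<rho> (indicator F)" .
qed

lemma fundamental_function_associate_norm:
  assumes "nonatomic M" "ri_norm M \<rho>" and E: "E \<in> sets M" "emeasure M E = ennreal t"
  shows "fundamental_function M (associate_norm M \<rho>) t = associate_norm M \<rho> (indicator E)"
proof -
  define F where "F = (SOME F. F \<in> sets M \<and> emeasure M F = ennreal t)"
  have "F \<in> sets M \<and> emeasure M F = ennreal t"
    unfolding F_def by (rule someI[of _ E]) (simp add: E)
  then have F: "F \<in> sets M" "emeasure M F = ennreal t" by auto
  have "E \<in> fmeasurable M" "F \<in> fmeasurable M" "measure M E = measure M F"
    using E F by (auto simp: fmeasurable_def measure_def)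
  then show ?thesis
    unfolding fundamental_function_def F_def[symmetric]
    by (intro antisym associate_norm_indicator_le[OF assms(1,2)]) auto
qed

text \<open>
  Normalizing \<open>h\<close> reduces the inequality to the definition of the associate norm. If \<open>h\<close> has infinite
  norm and \<open>E\<close> is not null, the right-hand side must be seen to be infinite, that is, the associate
  norm not to be \<open>0\<close>; this follows from the inequality for the indicator of \<open>E\<close>, whose norm is finite.
\<close>

lemma Hoelder_indicator:
  assumes "banach_function_norm M \<rho>" and h [measurable]: "h \<in> borel_measurable M"
    and E [measurable]: "E \<in> sets M" and fin: "emeasure M E < \<infinity>"
  shows "(\<integral>\<^sup>+x\<in>E. h x \<partial>M) \<le> \<rho> h * associate_norm M \<rho> (indicator E)"
proof -
  have zero: "\<rho> k = 0 \<longleftrightarrow> (AE x in M. k x = 0)" if "k \<in> borel_measurable M" for k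
    using assms(1) that unfolding banach_function_norm_def by blast
  have scale: "\<rho> (\<lambda>x. ennreal a * k x) = ennreal a * \<rho> k" if "k \<in> borel_measurable M" "0 \<le> a" for a k
    using assms(1) that unfolding banach_function_norm_def by blast
  have main: "(\<integral>\<^sup>+x\<in>E. k x \<partial>M) \<le> \<rho> k * associate_norm M \<rho> (indicator E)"
    if [measurable]: "k \<in> borel_measurable M" and k: "\<rho> k \<noteq> 0" "\<rho> k < \<infinity>" for k
  proof -
    define a where "a = enn2real (\<rho> k)"
    have a: "\<rho> k = ennreal a" "0 < a"
      using k by (auto simp: a_def enn2real_positive_iff zero_less_iff_neq_zero)
    have "\<rho> (\<lambda>x. ennreal (1 / a) * k x) = 1"
      using a by (simp add: scale flip: ennreal_mult)
    then have "(\<integral>\<^sup>+x. (ennreal (1 / a) * k x) * indicator E x \<partial>M) \<le> associate_norm M \<rho> (indicator E)"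
      by (intro associate_norm_upper) auto
    then have "ennreal a * (ennreal (1 / a) * (\<integral>\<^sup>+x\<in>E. k x \<partial>M)) \<le> ennreal a * associate_norm M \<rho> (indicator E)"
      by (intro mult_left_mono) (simp_all add: mult.assoc nn_integral_cmult)
    moreover have "ennreal a * (ennreal (1 / a) * y) = y" for y
      using a(2) by (simp add: mult.assoc[symmetric] flip: ennreal_mult)
    ultimately show ?thesis by (simp add: a(1))
  qed
  consider "\<rho> h = 0" | "\<rho> h \<noteq> 0" "\<rho> h < \<infinity>" | "\<rho> h = \<infinity>"
    using top.not_eq_extremum infinity_ennreal_def by metis
  then show ?thesis
  proof cases
    case 1
    then have "AE x in M. h x * indicator E x = 0" using zero[OF h] by auto
    then have "(\<integral>\<^sup>+x\<in>E. h x \<partial>M) = 0" by (subst nn_integral_0_iff_AE) auto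
    then show ?thesis by simp
  next
    case 2
    then show ?thesis by (intro main) auto
  next
    case 3
    show ?thesis
    proof (cases "emeasure M E = 0")
      case True
      then show ?thesis by (simp add: nn_integral_null_set null_setsI)
    next
      case False
      have "\<not> (AE x in M. indicator E x = (0::ennreal))"
      proof -
        have "{x\<in>space M. indicator E x \<noteq> (0::ennreal)} = E"
          using sets.sets_into_space[OF E] by (auto split: split_indicator)
        with False show ?thesis by (simp add: AE_iff_measurable[OF _ refl])
      qed
      then have "\<rho> (indicator E) \<noteq> 0" by (subst zero) auto
      moreover have "\<rho> (indicator E) < \<infinity>"
        using assms(1) E fin unfolding banach_function_norm_def by blast
      ultimately have "emeasure M E \<le> \<rho> (indicator E) * associate_norm M \<rho> (indicator E)"
        using main[of "indicator E"] by (simp add: indicator_inter_arith[symmetric])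
      with False have "associate_norm M \<rho> (indicator E) \<noteq> 0" by auto
      with 3 show ?thesis by (simp add: ennreal_top_mult)
    qed
  qed
qed

text \<open>
  The point where the space \<open>Z\<close> enters: the integral on the left is \<open>t\<close> times the maximal
  rearrangement of \<open>h\<close> at \<open>t\<close>.
\<close>

lemma integral_rearrangement_le:
  assumes na: "nonatomic M" and ri: "ri_norm M \<rho>" and h: "h \<in> borel_measurable M"
    and W: "W \<in> fmeasurable M" "\<And>x. x \<in> space M - W \<Longrightarrow> h x = 0"
    and t: "0 \<le> t" "t \<le> measure M W"
  shows "(\<integral>\<^sup>+u\<in>{0<..<t}. rearrangement M h u \<partial>lborel)
    \<le> \<rho> h * fundamental_function M (associate_norm M \<rho>) t"
proof -
  obtain E where E: "E \<in> sets M" "emeasure M E = ennreal t"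
    "\<And>y. emeasure M {x\<in>E. y < h x} = min (emeasure M {x\<in>space M. y < h x}) (ennreal t)"
    by (rule nonatomic_level_set[OF na h W t]) (assumption | (rule that; assumption))+
  have "(\<integral>\<^sup>+u\<in>{0<..<t}. rearrangement M h u \<partial>lborel) = (\<integral>\<^sup>+x\<in>E. h x \<partial>M)"
    using nn_integral_rearrangement[OF h E(1,2) t(1) E(3), of "\<lambda>y. y"] by simp
  also have "\<dots> \<le> \<rho> h * associate_norm M \<rho> (indicator E)"
    using ri h E by (intro Hoelder_indicator) (auto simp: ri_norm_def)
  also have "associate_norm M \<rho> (indicator E) = fundamental_function M (associate_norm M \<rho>) t"
    using fundamental_function_associate_norm[OF na ri E(1,2)] by simp
  finally show ?thesis .
qed

section \<open>The dimension is positive\<close>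

lemma nonatomic_null_singleton:
  assumes "nonatomic M" "{x} \<in> sets M"
  shows "emeasure M {x} = 0"
proof (rule ccontr)
  assume "emeasure M {x} \<noteq> 0"
  then have "0 < emeasure M {x}" by (simp add: zero_less_iff_neq_zero)
  then obtain B where "B \<subseteq> {x}" "0 < emeasure M B" "emeasure M B < emeasure M {x}"
    using assms unfolding nonatomic_def by meson
  then show False by (auto simp: subset_singleton_iff)
qed

text \<open>
  The smallest doubling constant \<open>Inf C\<close> is itself doubling. If it were at most \<open>1\<close>, halving the
  radius would not decrease the measure of a ball, and the limit of the balls of radius \<open>1 / 2 ^ n\<close>, a
  single point, would have positive measure and be an atom.
\<close>

lemma doubling_dimension_pos:
  fixes M :: "'a::metric_space measure"
  assumes hs: "homogeneous_space M" and na: "nonatomic M"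
  shows "0 < doubling_dimension M"
proof -
  define C where "C = {c. doubling_constant M c}"
  have sets: "sets M = sets borel" and bp: "\<And>x r. 0 < r \<Longrightarrow> 0 < emeasure M (ball x r)"
    and bf: "\<And>x r. 0 < r \<Longrightarrow> emeasure M (ball x r) < \<infinity>" and ne: "C \<noteq> {}"
    using hs by (auto simp: homogeneous_space_def C_def)
  have ball_fm: "ball x r \<in> fmeasurable M" if "0 < r" for x :: 'a and r
    using bf[OF that] sets by (auto simp: fmeasurable_def)
  have mp: "0 < measure M (ball x r)" if "0 < r" for x :: 'a and r
    using bp[OF that] bf[OF that] by (simp add: measure_def enn2real_positive_iff)
  fix x :: 'a
  have "1 < Inf C"
  proof (rule ccontr)
    assume "\<not> 1 < Inf C"
    have half: "measure M (ball x (2 * r)) \<le> measure M (ball x r)" if r: "0 < r" for r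
    proof -
      have "measure M (ball x (2 * r)) / measure M (ball x r) \<le> c" if "c \<in> C" for c
        using that r mp[OF r, of x] by (auto simp: C_def doubling_constant_def divide_le_eq)
      then have "measure M (ball x (2 * r)) / measure M (ball x r) \<le> Inf C"
        using ne by (intro cInf_greatest)
      also have "\<dots> \<le> 1" using \<open>\<not> 1 < Inf C\<close> by simp
      finally show ?thesis using mp[OF r, of x] by (simp add: divide_le_eq)
    qed
    have const: "measure M (ball x 1) \<le> measure M (ball x (1 / 2 ^ n))" for n
    proof (induction n)
      case (Suc n)
      with half[of "1 / 2 ^ Suc n"] show ?case by simp
    qed simp
    have "decseq (\<lambda>n. ball x (1 / 2 ^ n :: real))"
      by (intro decseq_SucI subset_ball) (simp add: field_simps)
    moreover have "(\<Inter>n. ball x (1 / 2 ^ n :: real)) = {x}"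
    proof (intro set_eqI iffI)
      fix y assume y: "y \<in> (\<Inter>n. ball x (1 / 2 ^ n :: real))"
      have "(\<lambda>n. 1 / 2 ^ n :: real) \<longlonglongrightarrow> 0" by (intro LIMSEQ_divide_realpow_zero) auto
      moreover have "dist x y \<le> 1 / 2 ^ n" for n using y by (auto intro: less_imp_le)
      ultimately have "dist x y \<le> 0" by (intro LIMSEQ_le_const) auto
      then show "y \<in> {x}" by simp
    qed auto
    ultimately have "(\<lambda>n. measure M (ball x (1 / 2 ^ n))) \<longlonglongrightarrow> measure M {x}"
      using Lim_measure_decseq[of "\<lambda>n. ball x (1 / 2 ^ n)" M] fmeasurableD2[OF ball_fm, of _ x] sets
      by (auto simp: image_subset_iff)
    then have "measure M (ball x 1) \<le> measure M {x}"
      using const by (intro LIMSEQ_le_const) auto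
    moreover have "measure M {x} = 0"
      using nonatomic_null_singleton[OF na, of x] sets by (simp add: measure_def)
    ultimately show False using mp[of 1 x] by simp
  qed
  then show ?thesis unfolding doubling_dimension_def C_def[symmetric] by simp
qed

section \<open>From the symmetrized inequality to norms\<close>

text \<open>
  Clearing the averages: the factors \<open>1 / u\<close> under the powers are collected into one power of \<open>u\<close>.
\<close>

lemma ennreal_powr_average_le:
  assumes u: "0 < u" and "0 < a" "0 < b" and c: "0 < c"
    and le: "ennreal (u powr d) * ennreal_powr (x / ennreal u) a \<le> ennreal c * ennreal_powr (y / ennreal u) b"
  shows "ennreal_powr x a \<le> ennreal (c * u powr (a - b - d)) * ennreal_powr y b"
proof -
  have avg: "ennreal_powr (z / ennreal u) e = ennreal_powr z e * ennreal (u powr - e)" if "0 < e" for z e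
  proof -
    have "z / ennreal u = z * ennreal (1 / u)"
      using u by (simp add: divide_ennreal_def inverse_ennreal inverse_eq_divide)
    then show ?thesis
      using u that by (simp add: ennreal_powr_mult ennreal_powr_ennreal powr_minus_divide powr_divide)
  qed
  \<comment> \<open>The factor that cancels the powers of \<open>u\<close> on the left-hand side of the assumption.\<close>
  define w where "w = ennreal (u powr (a - d))"
  have "ennreal_powr x a = w * (ennreal (u powr d) * ennreal_powr (x / ennreal u) a)"
  proof -
    have "u powr (a - d) * u powr d * u powr - a = 1" using u by (simp flip: powr_add)
    then have "w * ennreal (u powr d) * ennreal (u powr - a) = 1"
      unfolding w_def by (simp flip: ennreal_mult)
    moreover have "w * (ennreal (u powr d) * ennreal_powr (x / ennreal u) a)
        = w * ennreal (u powr d) * ennreal (u powr - a) * ennreal_powr x a"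
      unfolding avg[OF \<open>0 < a\<close>] by (simp only: mult_ac)
    ultimately show ?thesis by simp
  qed
  also have "\<dots> \<le> w * (ennreal c * ennreal_powr (y / ennreal u) b)"
    using le by (rule mult_left_mono) simp
  also have "\<dots> = ennreal (c * u powr (a - b - d)) * ennreal_powr y b"
  proof -
    have "u powr (a - d) * (c * u powr - b) = c * u powr (a - b - d)"
      using u by (simp add: algebra_simps flip: powr_add)
    then have "w * (ennreal c * ennreal (u powr - b)) = ennreal (c * u powr (a - b - d))"
      unfolding w_def using c by (simp flip: ennreal_mult)
    then show ?thesis unfolding avg[OF \<open>0 < b\<close>] by (metis mult.assoc mult.commute)
  qed
  finally show ?thesis .
qed

lemma sum_geometric_le:
  fixes x :: real
  assumes "0 \<le> x" "x < 1"
  shows "(\<Sum>k<n. x ^ k) \<le> 1 / (1 - x)"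
  using assms by (simp add: sum_gp_strict divide_right_mono)

text \<open>
  On \<open>(0, u/2)\<close> the decreasing function \<open>F\<close> is at least \<open>F (u/2)\<close>, so the integral of \<open>F - F u\<close> over
  \<open>(0, u)\<close> is at least \<open>u/2 * (F (u/2) - F u)\<close>. Hence \<open>F (u/2) - F u\<close> is at most
  \<open>2 * c * u powr a * K\<close>, and as \<open>F t = 0\<close> these increments add up along \<open>u = t / 2 ^ k\<close> to a geometric
  series of ratio \<open>2 powr - a < 1\<close>.
\<close>

lemma dyadic_oscillation_bound:
  fixes F :: "real \<Rightarrow> ennreal"
  assumes anti: "\<And>u v. u \<le> v \<Longrightarrow> F v \<le> F u" and t: "0 < t" "F t = 0"
    and a: "0 < a" and c: "0 < c"
    and osc: "\<And>u. 0 < u \<Longrightarrow> u \<le> t \<Longrightarrow>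
      (\<integral>\<^sup>+v\<in>{0<..<u}. (F v - F u) \<partial>lborel) \<le> ennreal (c * u powr (a + 1)) * K"
  shows "F (t / 2 ^ n) \<le> ennreal (2 * c / (1 - 2 powr - a) * t powr a) * K"
proof -
  have half: "F (u / 2) \<le> F u + ennreal (2 * c * u powr a) * K" if u: "0 < u" "u \<le> t" for u
  proof -
    have "ennreal (u / 2) * (F (u / 2) - F u) = (\<integral>\<^sup>+v\<in>{0<..<u/2}. (F (u / 2) - F u) \<partial>lborel)"
      using u by (simp add: nn_integral_cmult_indicator mult.commute)
    also have "\<dots> \<le> (\<integral>\<^sup>+v\<in>{0<..<u}. (F v - F u) \<partial>lborel)"
      using u by (intro nn_integral_mono)
        (auto split: split_indicator intro!: ennreal_minus_mono anti)
    also have "\<dots> \<le> ennreal (c * u powr (a + 1)) * K" using u by (rule osc)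
    finally have le: "ennreal (u / 2) * (F (u / 2) - F u) \<le> ennreal (c * u powr (a + 1)) * K" .
    have "F (u / 2) - F u = ennreal (2 / u) * (ennreal (u / 2) * (F (u / 2) - F u))"
      using u by (simp add: mult.assoc[symmetric] flip: ennreal_mult)
    also have "\<dots> \<le> ennreal (2 / u) * (ennreal (c * u powr (a + 1)) * K)"
      using le by (rule mult_left_mono) simp
    also have "\<dots> = ennreal (2 * c * u powr a) * K"
    proof -
      have "2 / u * (c * u powr (a + 1)) = 2 * c * u powr a"
        using u by (simp add: powr_add)
      then show ?thesis using u c by (simp add: mult.assoc[symmetric] flip: ennreal_mult)
    qed
    finally have "F u + (F (u / 2) - F u) \<le> F u + ennreal (2 * c * u powr a) * K"
      by (rule add_left_mono)
    moreover have "F u \<le> F (u / 2)" using u by (intro anti) simp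
    ultimately show ?thesis by (simp add: add_diff_inverse_ennreal)
  qed
  define x where "x = 2 powr - a"
  have x: "0 < x" "x < 1" using a by (auto simp: x_def powr_less_one)
  have tk: "(t / 2 ^ k) powr a = t powr a * x ^ k" for k
    using t by (simp add: x_def powr_divide powr_power powr_minus_divide powr_powr
        flip: powr_realpow) (simp add: mult.commute)
  have "F (t / 2 ^ n) \<le> ennreal (2 * c * t powr a * (\<Sum>k<n. x ^ k)) * K"
  proof (induction n)
    case 0
    then show ?case using t by simp
  next
    case (Suc n)
    have "t / 2 ^ n \<le> t" using t by (simp add: divide_le_eq)
    then have "F (t / 2 ^ n / 2) \<le> F (t / 2 ^ n) + ennreal (2 * c * (t / 2 ^ n) powr a) * K"
      using t by (intro half) auto
    also have "\<dots> \<le> ennreal (2 * c * t powr a * (\<Sum>k<n. x ^ k)) * K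
        + ennreal (2 * c * t powr a * x ^ n) * K"
      using Suc by (intro add_mono) (auto simp: tk mult.assoc)
    also have "\<dots> = ennreal (2 * c * t powr a * (\<Sum>k<Suc n. x ^ k)) * K"
      using c x by (subst distrib_right[symmetric], subst ennreal_plus[symmetric])
        (auto simp: sum_nonneg distrib_left)
    finally show ?case by (simp add: mult.commute)
  qed
  also have "\<dots> \<le> ennreal (2 * c / (1 - x) * t powr a) * K"
  proof (intro mult_right_mono ennreal_leI)
    show "2 * c * t powr a * (\<Sum>k<n. x ^ k) \<le> 2 * c / (1 - x) * t powr a"
      using mult_left_mono[OF sum_geometric_le[of x n], of "2 * c * t powr a"] x c by (simp add: mult_ac)
  qed simp
  finally show ?thesis by (simp add: x_def)
qed

text \<open>
  The values of the rearrangement near \<open>0\<close> see all of \<open>h\<close> except sets of arbitrarily small measure.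
\<close>

lemma esssup_le_of_rearrangement_le:
  assumes [measurable]: "h \<in> borel_measurable M"
    and u: "u \<longlonglongrightarrow> 0" and le: "\<And>n. rearrangement M h (u n) \<le> C"
  shows "esssup M h \<le> C"
proof (rule esssup_I)
  have "emeasure M {x\<in>space M. C < h x} \<le> ennreal (u n)" for n
    using le[of n] rearrangement_gt_iff[of h M C "u n"] by (simp add: not_less[symmetric])
  moreover have "(\<lambda>n. ennreal (u n)) \<longlonglongrightarrow> ennreal 0"
    using u by (rule tendsto_ennrealI)
  ultimately have "emeasure M {x\<in>space M. C < h x} \<le> 0"
    by (intro LIMSEQ_le_const) auto
  then show "AE x in M. h x \<le> C"
    by (subst AE_iff_measurable[OF _ refl]) (auto simp: not_le)
qed simp

lemma borel_measurable_power_ext: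
  assumes "poincare M \<Omega> p q cP \<sigma> f g"
  shows "power_ext \<Omega> q g \<in> borel_measurable M"
proof -
  have \<Omega>: "\<Omega> \<in> sets M" and g: "g \<in> borel_measurable (restrict_space M \<Omega>)"
    using assms by (auto simp: poincare_def)
  have "(\<lambda>x. ennreal (g x powr q)) \<in> borel_measurable (restrict_space M \<Omega>)"
    using g by measurable
  then have "(\<lambda>x. if x \<in> \<Omega> then ennreal (g x powr q) else 0) \<in> borel_measurable M"
    using \<Omega> by (subst measurable_restrict_space_iff[symmetric]) auto
  then show ?thesis by (simp add: power_ext_def[abs_def])
qed

lemma is_support_borel:
  assumes "f \<in> borel_measurable borel" "is_support f S"
  shows "S \<in> sets borel" and "\<And>x. x \<notin> S \<Longrightarrow> f x = 0"
proof -
  have "support_on UNIV f = {x\<in>space borel. f x \<noteq> 0}" by (auto simp: support_on_def)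
  also have "\<dots> \<in> sets borel" using assms(1) by measurable
  finally have "support_on UNIV f \<in> sets borel" .
  with assms(2) show "S \<in> sets borel" by (auto simp: is_support_def)
  have "support_on UNIV f \<subseteq> S" using assms(2) closure_subset by (auto simp: is_support_def)
  then show "\<And>x. x \<notin> S \<Longrightarrow> f x = 0" by (auto simp: support_on_def)
qed

lemma symmetrized_oscillation_bound:
  assumes c1: "0 < c1" and q: "0 < q" and p: "0 < p" and R: "(\<integral>\<^sup>+v\<in>{0<..<t}. rearrangement M h v \<partial>lborel) \<le> R"
    and u: "0 < u" "u \<le> t"
    and le: "ennreal (u powr (- 1 / s)) * ennreal_powr (x / ennreal u) (1 / p)
      \<le> ennreal c1 * ennreal_powr (maximal_rearrangement M h u) (1 / q)"
  shows "ennreal_powr x (1 / p) \<le> ennreal (c1 * u powr (1 / s + 1 / p - 1 / q)) * ennreal_powr R (1 / q)"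
proof -
  have "ennreal_powr x (1 / p) \<le> ennreal (c1 * u powr (1 / p - 1 / q - (- 1 / s)))
      * ennreal_powr (\<integral>\<^sup>+v\<in>{0<..<u}. rearrangement M h v \<partial>lborel) (1 / q)"
    using le u c1 p q unfolding maximal_rearrangement_def
    by (intro ennreal_powr_average_le) auto
  also have "\<dots> \<le> ennreal (c1 * u powr (1 / p - 1 / q - (- 1 / s))) * ennreal_powr R (1 / q)"
  proof (intro mult_left_mono ennreal_powr_mono)
    have "(\<integral>\<^sup>+v\<in>{0<..<u}. rearrangement M h v \<partial>lborel) \<le> (\<integral>\<^sup>+v\<in>{0<..<t}. rearrangement M h v \<partial>lborel)"
      using u by (intro nn_integral_mono) (auto split: split_indicator)
    then show "(\<integral>\<^sup>+v\<in>{0<..<u}. rearrangement M h v \<partial>lborel) \<le> R" using R by (rule order_trans)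
  qed (use q in auto)
  finally show ?thesis by (simp add: algebra_simps)
qed

theorem theorem3:
  fixes M :: "'a::metric_space measure"
    and \<rho> :: "('a \<Rightarrow> ennreal) \<Rightarrow> ennreal"
    and x0 :: 'a and r0 s c2 \<sigma> cP :: real
  assumes "homogeneous_space M"
    and "nonatomic M"
    and "s = doubling_dimension M"
    and "symmetrization_constant M c2"
    and "ri_norm M \<rho>"
    and "0 < r0" and "1 \<le> \<sigma>" and "0 < cP"
  shows
    "(\<forall>p q. 1 \<le> p \<and> 1 \<le> q \<longrightarrow>
       (\<exists>c>0. \<forall>f g S.
          f \<in> borel_measurable M \<and> is_support f S \<and> S \<subseteq> ball x0 r0 \<and>
          poincare M (ball x0 (4 * \<sigma> * r0)) p q cP \<sigma> f g \<and>
          measure M S < c2 * measure M (ball x0 r0) \<longrightarrow>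
          Lp_norm M p f
          \<le> ennreal c *
            ennreal_powr
              (\<rho> (power_ext (ball x0 (4 * \<sigma> * r0)) q g) *
               fundamental_function M (associate_norm M \<rho>) (measure M S)) (1 / q) *
            ennreal (measure M S powr ((s + p) / (s * p) - 1 / q)))) \<and>
     (\<forall>q. 1 \<le> q \<and> s < q \<longrightarrow>
       (\<exists>c>0. \<forall>f g S.
          f \<in> borel_measurable M \<and> is_support f S \<and> S \<subseteq> ball x0 r0 \<and>
          poincare M (ball x0 (4 * \<sigma> * r0)) 1 q cP \<sigma> f g \<and>
          measure M S < c2 * measure M (ball x0 r0) \<longrightarrow>
          Linf_norm M f
          \<le> ennreal c *
            ennreal_powr
              (\<rho> (power_ext (ball x0 (4 * \<sigma> * r0)) q g) *
               fundamental_function M (associate_norm M \<rho>) (measure M S)) (1 / q) *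
            ennreal (measure M S powr (1 / s - 1 / q))))"
proof -
  define W where "W = ball x0 (4 * \<sigma> * r0)"
  define R where "R q g t = \<rho> (power_ext W q g) * fundamental_function M (associate_norm M \<rho>) t" for q g t
  have sets: "sets M = sets borel"
    using assms(1) by (simp add: homogeneous_space_def)
  have meas: "borel_measurable M = (borel_measurable borel :: ('a \<Rightarrow> real) set)"
    by (rule measurable_cong_sets[OF sets refl])
  have s: "0 < s" using doubling_dimension_pos[OF assms(1,2)] assms(3) by simp
  have r0: "r0 \<le> 4 * \<sigma> * r0" using assms(6,7) by simp
  have ball_fm: "ball x r \<in> fmeasurable M" if "0 < r" for x r
    using assms(1) that by (auto simp: fmeasurable_def homogeneous_space_def)
  have c2: "c2 \<le> 1" using assms(4) by (simp add: symmetrization_constant_def)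
  have W: "W \<in> fmeasurable M" unfolding W_def using assms(6) r0 by (intro ball_fm) linarith
  \<comment> \<open>Both parts come from this inequality: (i) at \<open>u = measure M S\<close>, (ii) with \<open>p = 1\<close> at all smaller
      \<open>u\<close> as well. Its right-hand side involves \<open>R\<close> at \<open>measure M S\<close> for every \<open>u\<close>.\<close>
  have oscillation: "\<exists>c1>0. \<forall>f g S u.
      f \<in> borel_measurable M \<and> is_support f S \<and> S \<subseteq> ball x0 r0 \<and> poincare M W p q cP \<sigma> f g \<and>
      measure M S < c2 * measure M (ball x0 r0) \<and> 0 < u \<and> u \<le> measure M S \<longrightarrow>
      (let F = rearrangement M (\<lambda>x. ennreal \<bar>f x\<bar>) in
       ennreal_powr (\<integral>\<^sup>+v\<in>{0<..<u}. ennreal_powr (F v - F u) p \<partial>lborel) (1 / p)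
       \<le> ennreal (c1 * u powr (1 / s + 1 / p - 1 / q)) * ennreal_powr (R q g (measure M S)) (1 / q))"
    if pq: "1 \<le> p" "1 \<le> q" for p q
  proof -
    note ex = assms(4)[unfolded symmetrization_constant_def, THEN conjunct2, THEN conjunct2,
      rule_format, OF pq assms(7,8,6), of x0, folded W_def]
    obtain c1 where c1: "0 < c1" and sym: "\<And>f g t. poincare M W p q cP \<sigma> f g \<Longrightarrow> 0 < t \<Longrightarrow>
        t < c2 * measure M (ball x0 r0) \<Longrightarrow>
        (let F = rearrangement M (\<lambda>x. ennreal \<bar>f x\<bar> * indicator (ball x0 r0) x) in
              ennreal (t powr (- 1 / doubling_dimension M)) *
              ennreal_powr
                ((\<integral>\<^sup>+u\<in>{0<..<t}. ennreal_powr (F u - F t) p \<partial>lborel) / ennreal t) (1 / p)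
              \<le> ennreal c1 *
                ennreal_powr
                  (maximal_rearrangement M (power_ext W q g) t) (1 / q))"
      by (rule exE[OF ex]) (rule that; blast)
    show ?thesis
    proof (intro exI[of _ c1] conjI c1 allI impI, elim conjE)
      fix f :: "'a \<Rightarrow> real" and g S u
      assume f: "f \<in> borel_measurable M" and S: "is_support f S" "S \<subseteq> ball x0 r0"
        and P: "poincare M W p q cP \<sigma> f g" and t: "measure M S < c2 * measure M (ball x0 r0)"
        and u: "0 < u" "u \<le> measure M S"
      define G where "G = power_ext W q g"
      have "f x = 0" if "x \<notin> ball x0 r0" for x
      proof -
        have "x \<notin> S" using S(2) that by blast
        then show ?thesis using is_support_borel(2)[OF _ S(1)] f by (simp add: meas)
      qed
      then have eqf: "(\<lambda>x. ennreal \<bar>f x\<bar> * indicator (ball x0 r0) x) = (\<lambda>x. ennreal \<bar>f x\<bar>)"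
        by (auto simp: fun_eq_iff split: split_indicator)
      have "measure M S \<le> measure M (ball x0 r0)"
        using t mult_right_mono[OF c2 measure_nonneg[of M "ball x0 r0"]] by simp
      also have "\<dots> \<le> measure M W"
        using W r0 ball_fm[OF assms(6)] unfolding W_def by (intro measure_mono_fmeasurable) auto
      finally have "measure M S \<le> measure M W" .
      then have int: "(\<integral>\<^sup>+v\<in>{0<..<measure M S}. rearrangement M G v \<partial>lborel) \<le> R q g (measure M S)"
        unfolding R_def G_def
        by (intro integral_rearrangement_le[OF assms(2,5) borel_measurable_power_ext[OF P] W])
          (auto simp: power_ext_def)
      show "let F = rearrangement M (\<lambda>x. ennreal \<bar>f x\<bar>) in
          ennreal_powr (\<integral>\<^sup>+v\<in>{0<..<u}. ennreal_powr (F v - F u) p \<partial>lborel) (1 / p)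
          \<le> ennreal (c1 * u powr (1 / s + 1 / p - 1 / q)) * ennreal_powr (R q g (measure M S)) (1 / q)"
        unfolding Let_def
      proof (rule symmetrized_oscillation_bound[OF c1 _ _ int u])
        have "u < c2 * measure M (ball x0 r0)" using u t by simp
        from sym[OF P u(1) this]
        show "ennreal (u powr (- 1 / s)) * ennreal_powr ((\<integral>\<^sup>+v\<in>{0<..<u}. ennreal_powr
              (rearrangement M (\<lambda>x. ennreal \<bar>f x\<bar>) v - rearrangement M (\<lambda>x. ennreal \<bar>f x\<bar>) u) p \<partial>lborel)
              / ennreal u) (1 / p)
            \<le> ennreal c1 * ennreal_powr (maximal_rearrangement M G u) (1 / q)"
          unfolding Let_def eqf G_def assms(3) .
      qed (use pq in auto)
    qed
  qed
  have support: "S \<in> sets M" "emeasure M S = ennreal (measure M S)" "\<And>x. x \<notin> S \<Longrightarrow> f x = 0"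
    "rearrangement M (\<lambda>x. ennreal \<bar>f x\<bar>) (measure M S) = 0"
    if f: "f \<in> borel_measurable M" and S: "is_support f S" "S \<subseteq> ball x0 r0" for f :: "'a \<Rightarrow> real" and S
  proof -
    have f': "f \<in> borel_measurable borel" using f by (simp add: meas)
    show S': "S \<in> sets M" using is_support_borel(1)[OF f' S(1)] sets by simp
    show zero: "f x = 0" if "x \<notin> S" for x using is_support_borel(2)[OF f' S(1) that] .
    have "S \<in> fmeasurable M" using S(2) S' ball_fm[OF assms(6)] by (meson fmeasurableI2)
    then show em: "emeasure M S = ennreal (measure M S)" by (simp add: emeasure_eq_measure2)
    have "(\<lambda>x. ennreal \<bar>f x\<bar>) \<in> borel_measurable M" using f by measurable
    moreover have "emeasure M {x\<in>space M. 0 < ennreal \<bar>f x\<bar>} \<le> ennreal (measure M S)"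
      unfolding em[symmetric] using S' zero by (intro emeasure_mono) auto
    ultimately have "\<not> 0 < rearrangement M (\<lambda>x. ennreal \<bar>f x\<bar>) (measure M S)"
      by (simp add: rearrangement_gt_iff not_less)
    then show "rearrangement M (\<lambda>x. ennreal \<bar>f x\<bar>) (measure M S) = 0" by (simp add: zero_less_iff_neq_zero)
  qed
  have null: "AE x in M. f x = 0"
    if "S \<in> sets M" "emeasure M S = ennreal (measure M S)" "measure M S = 0" "\<And>x. x \<notin> S \<Longrightarrow> f x = 0"
    for f :: "'a \<Rightarrow> real" and S
    using that by (intro AE_I[of _ _ S]) auto
  have part1: "\<exists>c>0. \<forall>f g S.
      f \<in> borel_measurable M \<and> is_support f S \<and> S \<subseteq> ball x0 r0 \<and> poincare M W p q cP \<sigma> f g \<and>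
      measure M S < c2 * measure M (ball x0 r0) \<longrightarrow>
      Lp_norm M p f \<le> ennreal c * ennreal_powr (R q g (measure M S)) (1 / q) *
        ennreal (measure M S powr ((s + p) / (s * p) - 1 / q))"
    if pq: "1 \<le> p" "1 \<le> q" for p q
  proof -
    from oscillation[OF pq] obtain c1 where c1: "0 < c1" and osc: "\<And>f g S u.
      f \<in> borel_measurable M \<and> is_support f S \<and> S \<subseteq> ball x0 r0 \<and> poincare M W p q cP \<sigma> f g \<and>
      measure M S < c2 * measure M (ball x0 r0) \<and> 0 < u \<and> u \<le> measure M S \<Longrightarrow>
      (let F = rearrangement M (\<lambda>x. ennreal \<bar>f x\<bar>) in
       ennreal_powr (\<integral>\<^sup>+v\<in>{0<..<u}. ennreal_powr (F v - F u) p \<partial>lborel) (1 / p)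
       \<le> ennreal (c1 * u powr (1 / s + 1 / p - 1 / q)) * ennreal_powr (R q g (measure M S)) (1 / q))"
      by blast
    show ?thesis
    proof (intro exI[of _ c1] conjI c1 allI impI, elim conjE)
      fix f :: "'a \<Rightarrow> real" and g S
      assume f [measurable]: "f \<in> borel_measurable M" and S: "is_support f S" "S \<subseteq> ball x0 r0"
        and P: "poincare M W p q cP \<sigma> f g" and t: "measure M S < c2 * measure M (ball x0 r0)"
      note supp = support[OF f S]
      define h where "h = (\<lambda>x. ennreal \<bar>f x\<bar>)"
      have h [measurable]: "h \<in> borel_measurable M" unfolding h_def by measurable
      have pw: "ennreal_powr (h x) p * indicator S x = ennreal (\<bar>f x\<bar> powr p)" for x
        using supp(3)[of x] pq by (auto simp: h_def ennreal_powr_ennreal split: split_indicator)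
      show "Lp_norm M p f \<le> ennreal c1 * ennreal_powr (R q g (measure M S)) (1 / q) *
        ennreal (measure M S powr ((s + p) / (s * p) - 1 / q))"
      proof (cases "measure M S = 0")
        case True
        have "AE x in M. ennreal (\<bar>f x\<bar> powr p) = 0"
          using null[OF supp(1,2) True supp(3)] pq by auto
        then have "(\<integral>\<^sup>+x. ennreal (\<bar>f x\<bar> powr p) \<partial>M) = 0"
          by (subst nn_integral_0_iff_AE) auto
        then show ?thesis using pq by (simp add: Lp_norm_def ennreal_powr_def)
      next
        case False
        then have pos: "0 < measure M S" by (simp add: zero_less_measure_iff)
        have "{x\<in>space M. y < h x} \<subseteq> S" for y
        proof
          fix x assume "x \<in> {x\<in>space M. y < h x}"
          then show "x \<in> S" using supp(3)[of x] by (cases "x \<in> S") (auto simp: h_def)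
        qed
        then have lev: "{x\<in>space M. y < h x} = {x\<in>S. y < h x}" for y
          using sets.sets_into_space[OF supp(1)] by auto
        have "emeasure M {x\<in>S. y < h x} \<le> ennreal (measure M S)" for y
          unfolding supp(2)[symmetric] using supp(1) by (intro emeasure_mono) auto
        then have "(\<integral>\<^sup>+u\<in>{0<..<measure M S}. ennreal_powr (rearrangement M h u) p \<partial>lborel)
            = (\<integral>\<^sup>+x\<in>S. ennreal_powr (h x) p \<partial>M)"
          using lev by (intro nn_integral_rearrangement[OF h supp(1,2)]) (auto simp: min_absorb1)
        moreover have "rearrangement M h (measure M S) = 0" using supp(4) by (simp add: h_def)
        ultimately have "Lp_norm M p f \<le> ennreal (c1 * measure M S powr (1 / s + 1 / p - 1 / q))
            * ennreal_powr (R q g (measure M S)) (1 / q)"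
          using osc[of f S g "measure M S"] f S P t pos
          by (simp add: Lp_norm_def h_def[symmetric] pw)
        also have "\<dots> = ennreal c1 * ennreal_powr (R q g (measure M S)) (1 / q) *
            ennreal (measure M S powr ((s + p) / (s * p) - 1 / q))"
        proof -
          have "(s + p) / (s * p) = 1 / s + 1 / p" using s pq by (simp add: field_simps)
          then show ?thesis using c1 by (simp add: ennreal_mult mult_ac)
        qed
        finally show ?thesis .
      qed
    qed
  qed
  have part2: "\<exists>c>0. \<forall>f g S.
      f \<in> borel_measurable M \<and> is_support f S \<and> S \<subseteq> ball x0 r0 \<and> poincare M W 1 q cP \<sigma> f g \<and>
      measure M S < c2 * measure M (ball x0 r0) \<longrightarrow>
      Linf_norm M f \<le> ennreal c * ennreal_powr (R q g (measure M S)) (1 / q) *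
        ennreal (measure M S powr (1 / s - 1 / q))"
    if q: "1 \<le> q" "s < q" for q
  proof -
    define a where "a = 1 / s - 1 / q"
    have a: "0 < a" using s q by (simp add: a_def field_simps)
    from oscillation[OF order_refl q(1)] obtain c1 where c1: "0 < c1" and osc: "\<And>f g S u.
      f \<in> borel_measurable M \<and> is_support f S \<and> S \<subseteq> ball x0 r0 \<and> poincare M W 1 q cP \<sigma> f g \<and>
      measure M S < c2 * measure M (ball x0 r0) \<and> 0 < u \<and> u \<le> measure M S \<Longrightarrow>
      (let F = rearrangement M (\<lambda>x. ennreal \<bar>f x\<bar>) in
       ennreal_powr (\<integral>\<^sup>+v\<in>{0<..<u}. ennreal_powr (F v - F u) 1 \<partial>lborel) (1 / 1)
       \<le> ennreal (c1 * u powr (1 / s + 1 / 1 - 1 / q)) * ennreal_powr (R q g (measure M S)) (1 / q))"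
      by blast
    have powr1: "ennreal_powr z 1 = z" for z
      by (cases z) (auto simp: ennreal_powr_def)
    define c where "c = 2 * c1 / (1 - 2 powr - a)"
    have c: "0 < c" using c1 a by (auto simp: c_def powr_less_one)
    show ?thesis
    proof (intro exI[of _ c] conjI c allI impI, elim conjE)
      fix f :: "'a \<Rightarrow> real" and g S
      assume f [measurable]: "f \<in> borel_measurable M" and S: "is_support f S" "S \<subseteq> ball x0 r0"
        and P: "poincare M W 1 q cP \<sigma> f g" and t: "measure M S < c2 * measure M (ball x0 r0)"
      note supp = support[OF f S]
      define h where "h = (\<lambda>x. ennreal \<bar>f x\<bar>)"
      have h [measurable]: "h \<in> borel_measurable M" unfolding h_def by measurable
      show "Linf_norm M f \<le> ennreal c * ennreal_powr (R q g (measure M S)) (1 / q) *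
        ennreal (measure M S powr (1 / s - 1 / q))"
      proof (cases "measure M S = 0")
        case True
        have "AE x in M. h x \<le> 0"
          using null[OF supp(1,2) True supp(3)] by (auto simp: h_def)
        then have "esssup M h \<le> 0" by (intro esssup_I) auto
        then show ?thesis by (simp add: Linf_norm_def h_def)
      next
        case False
        then have pos: "0 < measure M S" by (simp add: zero_less_measure_iff)
        have bound: "rearrangement M h (measure M S / 2 ^ n)
            \<le> ennreal (c * measure M S powr a) * ennreal_powr (R q g (measure M S)) (1 / q)" for n
          unfolding c_def
        proof (rule dyadic_oscillation_bound[OF rearrangement_antimono pos _ a c1])
          show "rearrangement M h (measure M S) = 0" using supp(4) by (simp add: h_def)
          fix u assume u: "0 < u" "u \<le> measure M S"
          have exponent: "1 / s + 1 - 1 / q = a + 1" by (simp add: a_def)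
          from osc[of f S g u] f S P t u
          show "(\<integral>\<^sup>+v\<in>{0<..<u}. (rearrangement M h v - rearrangement M h u) \<partial>lborel)
              \<le> ennreal (c1 * u powr (a + 1)) * ennreal_powr (R q g (measure M S)) (1 / q)"
            by (simp add: powr1 h_def Let_def exponent)
        qed
        have "(\<lambda>n. measure M S / 2 ^ n) \<longlonglongrightarrow> 0"
          by (intro LIMSEQ_divide_realpow_zero) auto
        then have "esssup M h \<le> ennreal (c * measure M S powr a) * ennreal_powr (R q g (measure M S)) (1 / q)"
          using bound by (rule esssup_le_of_rearrangement_le[OF h])
        then show ?thesis
          using c by (simp add: Linf_norm_def h_def a_def[symmetric] ennreal_mult mult_ac)
      qed
    qed
  qed
  from part1 part2 show ?thesis unfolding R_def W_def by blast
qed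

end
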